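(* Let $B$ be an exponential Blaschke product. Then for any $a\in\mathbb{D}$ the function $(B-a)/(1-\overline{a}B)$ is also an exponential Blaschke product (up to multiplication by a unimodular constant).
   Context: Let $\mathbb{D}$ be the open unit disc of the complex plane. A Blaschke product is a (finite or infinite) product $B(z)=\prod_{n}\frac{\overline{z}_{n}}{|z_{n}|}\frac{z_{n}-z}{1-\overline{z}_{n}z}$, $z\in\mathbb{D}$, with zeros $z_n\in\mathbb{D}$ (repeated according to multiplicity) satisfying $\sum_n(1-|z_n|)<\infty$, with the convention $\overline{z}/|z|=1$ if $z=0$. A Blaschke product $B$ is called an exponential Blaschke product if there exists a constant $M=M(B)>0$ such that for any $k=1,2,\dotsc$ one has $\#\{z: B(z)=0,\ 2^{-k-1}\le 1-|z|\le 2^{-k}\}\le M$, where zeros are counted with multiplicity. *)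

theory Defs
  imports "HOL-Complex_Analysis.Complex_Analysis"
begin

definition blaschke_factor :: "complex \<Rightarrow> complex \<Rightarrow> complex" where
  "blaschke_factor w z =
     (if w = 0 then 1 else cnj w / of_real (cmod w)) * ((w - z) / (1 - cnj w * z))"

text \<open>
  The zeros are listed with repetition as the values \<open>a n\<close> for \<open>n\<close> in an index set
  \<open>I\<close> of natural numbers. Both finite (possibly empty) and infinite \<open>I\<close> are allowed.
\<close>
definition blaschke_sequence :: "nat set \<Rightarrow> (nat \<Rightarrow> complex) \<Rightarrow> bool" where
  "blaschke_sequence I a \<longleftrightarrow>
     (\<forall>n\<in>I. a n \<in> ball 0 1) \<and> (\<lambda>n. 1 - cmod (a n)) summable_on I"

text \<open>
  A function on the unit disc is represented by a total function whose values outside the disc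
  are irrelevant. The relation \<open>has_prod\<close> allows finitely many vanishing factors.
\<close>
definition blaschke_product :: "(complex \<Rightarrow> complex) \<Rightarrow> bool" where
  "blaschke_product B \<longleftrightarrow>
     (\<exists>I a. blaschke_sequence I a \<and>
        (\<forall>z\<in>ball 0 1. (\<lambda>n. if n \<in> I then blaschke_factor (a n) z else 1) has_prod B z))"

definition dyadic_zeros :: "(complex \<Rightarrow> complex) \<Rightarrow> nat \<Rightarrow> complex set" where
  "dyadic_zeros B k =
     {z \<in> ball 0 1. B z = 0 \<and> 1 / 2 ^ (k + 1) \<le> 1 - cmod z \<and> 1 - cmod z \<le> 1 / 2 ^ k}"

text \<open>
  Finiteness is required explicitly because a sum over an infinite set is \<open>0\<close> by convention.
\<close>
definition exponential_blaschke_product :: "(complex \<Rightarrow> complex) \<Rightarrow> bool" where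
  "exponential_blaschke_product B \<longleftrightarrow>
     blaschke_product B \<and>
     (\<exists>M::real. M > 0 \<and>
        (\<forall>k\<ge>1. finite (dyadic_zeros B k) \<and>
           real_of_int (\<Sum>z\<in>dyadic_zeros B k. zorder B z) \<le> M))"

end

theory Submission
  imports Defs
begin

text \<open>
  Let \<open>b = (B - a) / (1 - cnj a * B)\<close> with \<open>a \<noteq> 0\<close>, and measure distances by the modulus of a Blaschke
  factor. Bounding \<open>1 - \<bar>B z\<bar>\<^sup>2\<close> by the sum over the zeros of \<open>1 - \<rho>\<^sup>2\<close> shows that a point where \<open>\<bar>B\<bar>\<close>
  is bounded away from \<open>1\<close> lies near a zero of \<open>B\<close> of comparable dyadic level. In particular this holds
  for the zeros of \<open>b\<close>; and since \<open>\<bar>b\<bar> = \<bar>a\<bar>\<close> at the zeros of \<open>B\<close>, only boundedly many zeros of \<open>b\<close>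
  are near a given one. Hence the zeros of \<open>b\<close> satisfy the exponential condition, and \<open>b = \<beta> g\<close> with \<open>\<beta>\<close>
  their Blaschke product and \<open>g\<close> zero-free and bounded by \<open>1\<close>. Harnack's inequality, started from the
  zeros of \<open>B\<close>, bounds \<open>\<bar>g\<bar>\<close> from below. On the circle \<open>\<bar>z\<bar> = 1 - 2\<^sup>-\<^sup>k\<close>, \<open>\<bar>g\<bar>\<close> is close to \<open>1\<close> off a
  bounded number of discs of radius \<open>O(2\<^sup>-\<^sup>k)\<close>, so a maximum principle argument yields \<open>\<bar>g 0\<bar> = 1\<close>,
  that is, \<open>g\<close> is a unimodular constant.
\<close>

subsection \<open>Blaschke factors\<close>

lemma one_minus_cnj_mult_nonzero:
  assumes "cmod w < 1" "cmod z < 1"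
  shows "1 - cnj w * z \<noteq> 0"
proof
  assume "1 - cnj w * z = 0"
  then have "cmod (cnj w * z) = 1" by simp
  moreover have "cmod (cnj w * z) < 1"
    using assms norm_mult_less[of "cnj w" 1 z 1] by simp
  ultimately show False by simp
qed

lemma norm_blaschke_factor:
  "cmod (blaschke_factor w z) = cmod (w - z) / cmod (1 - cnj w * z)"
  by (auto simp: blaschke_factor_def norm_mult norm_divide)

text \<open>The modulus of \<open>blaschke_factor w z\<close> is the pseudohyperbolic distance of
  \<open>w\<close> and \<open>z\<close>; the estimates in terms of \<open>1 - |w|\<close> and
  \<open>1 - |z|\<close> below come from this identity.\<close>

lemma one_minus_norm_blaschke_factor_sq:
  assumes "cmod w < 1" "cmod z < 1"
  shows "1 - (cmod (blaschke_factor w z))\<^sup>2 =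
         (1 - (cmod w)\<^sup>2) * (1 - (cmod z)\<^sup>2) / (cmod (1 - cnj w * z))\<^sup>2"
proof -
  have "(cmod (1 - cnj w * z))\<^sup>2 - (cmod (w - z))\<^sup>2 = (1 - (cmod w)\<^sup>2) * (1 - (cmod z)\<^sup>2)"
    unfolding cmod_power2 by (simp add: algebra_simps power2_eq_square)
  moreover have "cmod (1 - cnj w * z) \<noteq> 0"
    using one_minus_cnj_mult_nonzero[OF assms] by simp
  ultimately show ?thesis
    by (simp add: norm_blaschke_factor power_divide field_simps)
qed

lemma norm_blaschke_factor_less_1:
  assumes "cmod w < 1" "cmod z < 1"
  shows "cmod (blaschke_factor w z) < 1"
proof -
  have "0 < (1 - (cmod w)\<^sup>2) * (1 - (cmod z)\<^sup>2) / (cmod (1 - cnj w * z))\<^sup>2"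
    using assms one_minus_cnj_mult_nonzero[OF assms]
    by (intro divide_pos_pos mult_pos_pos) (auto simp: power_less_one_iff abs_square_less_1)
  then have "(cmod (blaschke_factor w z))\<^sup>2 < 1"
    using one_minus_norm_blaschke_factor_sq[OF assms] by simp
  then show ?thesis
    using abs_square_less_1 by force
qed

lemma blaschke_factor_eq_0_iff:
  assumes "cmod w < 1" "cmod z < 1"
  shows "blaschke_factor w z = 0 \<longleftrightarrow> z = w"
  using one_minus_cnj_mult_nonzero[OF assms] by (auto simp: blaschke_factor_def)

lemma blaschke_factor_holomorphic:
  assumes "cmod w < 1"
  shows "blaschke_factor w holomorphic_on ball 0 1"
  unfolding blaschke_factor_def[abs_def]
  using one_minus_cnj_mult_nonzero[OF assms]
  by (cases "w = 0") (auto intro!: holomorphic_intros)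

lemma zorder_blaschke_factor_self:
  assumes "cmod w < 1"
  shows "zorder (blaschke_factor w) w = 1"
proof -
  define c where "c = (if w = 0 then 1 else cnj w / of_real (cmod w))"
  show ?thesis
  proof (rule simple_zeroI[of "ball 0 1"])
    show "(\<lambda>z. - c / (1 - cnj w * z)) holomorphic_on ball 0 1"
      using one_minus_cnj_mult_nonzero[OF assms] by (auto intro!: holomorphic_intros)
    show "- c / (1 - cnj w * w) \<noteq> 0"
      using one_minus_cnj_mult_nonzero[OF assms assms] by (auto simp: c_def)
    show "blaschke_factor w z = - c / (1 - cnj w * z) * (z - w)" for z
      by (simp add: blaschke_factor_def c_def divide_simps) (simp add: algebra_simps)
  qed (use assms in auto)
qed

lemma norm_one_minus_cnj_mult_ge:
  assumes "cmod w < 1" "cmod z < 1"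
  shows "1 - cmod w \<le> cmod (1 - cnj w * z)" "1 - cmod z \<le> cmod (1 - cnj w * z)"
proof -
  have "1 - cmod w * cmod z \<le> cmod (1 - cnj w * z)"
    using norm_triangle_ineq2[of 1 "cnj w * z"] by (simp add: norm_mult)
  moreover have "cmod w * cmod z \<le> cmod w" "cmod w * cmod z \<le> cmod z"
    using assms by (auto intro: mult_left_le mult_left_le_one_le)
  ultimately show "1 - cmod w \<le> cmod (1 - cnj w * z)" "1 - cmod z \<le> cmod (1 - cnj w * z)"
    by linarith+
qed

text \<open>The unimodular constant in the factor makes it tend to \<open>1\<close> as
  \<open>w\<close> approaches the circle. This is the termwise bound behind the convergence of the
  product.\<close>

lemma norm_blaschke_factor_minus_1_le:
  assumes "cmod w < 1" "cmod z < 1"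
  shows "cmod (blaschke_factor w z - 1) \<le> 2 * (1 - cmod w) / (1 - cmod z)"
proof (cases "w = 0")
  case True
  have "cmod (- z - 1) \<le> cmod z + 1"
    using norm_triangle_ineq4[of "- z" 1] by simp
  also have "\<dots> \<le> 2 / (1 - cmod z)"
  proof -
    have "(cmod z + 1) * (1 - cmod z) \<le> 2"
      by (simp add: algebra_simps)
    then show ?thesis using assms by (simp add: field_simps)
  qed
  finally show ?thesis using True by (simp add: blaschke_factor_def)
next
  case False
  have nz: "1 - cnj w * z \<noteq> 0" by (rule one_minus_cnj_mult_nonzero[OF assms])
  define r where "r = cmod w"
  have r: "r > 0" "r < 1" and ww: "w * cnj w = of_real (r\<^sup>2)"
    using False assms by (auto simp: r_def complex_norm_square simp flip: of_real_power)
  have "blaschke_factor w z - 1 =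
        (cnj w * (w - z) - of_real r * (1 - cnj w * z)) / (of_real r * (1 - cnj w * z))"
    using False nz r by (simp add: blaschke_factor_def r_def[symmetric] field_simps)
  \<comment> \<open>Since \<open>w * cnj w = r^2\<close>, the numerator factors. Its second factor
    is at most \<open>2 * r\<close>, which cancels the \<open>r\<close> of the denominator.\<close>
  also have "cnj w * (w - z) - of_real r * (1 - cnj w * z) =
             of_real (r - 1) * (of_real r + cnj w * z)"
    using ww by (simp add: algebra_simps power2_eq_square)
  finally have "cmod (blaschke_factor w z - 1) =
                (1 - r) * cmod (of_real r + cnj w * z) / (r * cmod (1 - cnj w * z))"
    using r by (simp add: norm_divide norm_mult del: of_real_diff)
  also have "\<dots> \<le> (1 - r) * (2 * r) / (r * (1 - cmod z))"
  proof (intro frac_le mult_left_mono)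
    have "cmod (of_real r + cnj w * z) \<le> r + r * cmod z"
      using norm_triangle_ineq[of "of_real r" "cnj w * z"] r by (simp add: norm_mult r_def)
    also have "\<dots> \<le> 2 * r"
      using r assms by simp
    finally show "cmod (of_real r + cnj w * z) \<le> 2 * r" .
  qed (use r assms norm_one_minus_cnj_mult_ge[OF assms] in auto)
  also have "\<dots> = 2 * (1 - r) / (1 - cmod z)"
    using r by simp
  finally show ?thesis by (simp add: r_def)
qed

text \<open>\<open>|1 - cnj w * z|\<close> dominates both \<open>1 - |w|\<close> and
  \<open>1 - |z|\<close>. Two points at very different distances from the circle are therefore
  almost at pseudohyperbolic distance \<open>1\<close>, whichever of them is closer to it.\<close>

lemma one_minus_norm_blaschke_factor_sq_le:
  assumes "cmod w < 1" "cmod z < 1"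
  shows "1 - (cmod (blaschke_factor w z))\<^sup>2 \<le> 4 * ((1 - cmod w) / (1 - cmod z))"
    and "1 - (cmod (blaschke_factor w z))\<^sup>2 \<le> 4 * ((1 - cmod z) / (1 - cmod w))"
proof -
  define s t D where "s = 1 - cmod w" and "t = 1 - cmod z" and "D = cmod (1 - cnj w * z)"
  have st: "0 < s" "s \<le> 1" "0 < t" "t \<le> 1" "s \<le> D" "t \<le> D"
    using assms norm_one_minus_cnj_mult_ge[OF assms] by (auto simp: s_def t_def D_def)
  have *: "1 - (cmod w)\<^sup>2 \<le> 2 * s" "1 - (cmod z)\<^sup>2 \<le> 2 * t"
    using zero_le_power2[of "1 - cmod w"] zero_le_power2[of "1 - cmod z"]
    by (auto simp: s_def t_def power2_eq_square algebra_simps)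
  have "(1 - (cmod w)\<^sup>2) * (1 - (cmod z)\<^sup>2) \<le> (2 * s) * (2 * t)"
    using st assms * by (intro mult_mono) (auto simp: abs_square_le_1)
  then have le: "1 - (cmod (blaschke_factor w z))\<^sup>2 \<le> 4 * s * t / D\<^sup>2"
    unfolding one_minus_norm_blaschke_factor_sq[OF assms] D_def[symmetric]
    by (intro divide_right_mono) auto
  also have "\<dots> \<le> 4 * s * t / t\<^sup>2"
    using st by (intro divide_left_mono) (auto intro!: power_mono mult_pos_pos)
  finally show "1 - (cmod (blaschke_factor w z))\<^sup>2 \<le> 4 * ((1 - cmod w) / (1 - cmod z))"
    using st by (simp add: s_def[symmetric] t_def[symmetric] power2_eq_square)
  note le
  also have "4 * s * t / D\<^sup>2 \<le> 4 * s * t / s\<^sup>2"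
    using st by (intro divide_left_mono) (auto intro!: power_mono mult_pos_pos)
  finally show "1 - (cmod (blaschke_factor w z))\<^sup>2 \<le> 4 * ((1 - cmod z) / (1 - cmod w))"
    using st by (simp add: s_def[symmetric] t_def[symmetric] power2_eq_square)
qed

text \<open>Follows from the crude bound \<open>|1 - cnj w * z| \<le> 2\<close>. At a fixed
  \<open>z\<close> it controls \<open>1 - |w|\<close>, which leads to the Blaschke condition for the
  zeros of a bounded function.\<close>

lemma one_minus_norm_blaschke_factor_sq_ge:
  assumes "cmod w < 1" "cmod z < 1"
  shows "(1 - cmod z) * (1 - cmod w) / 4 \<le> 1 - (cmod (blaschke_factor w z))\<^sup>2"
proof -
  have "cmod (1 - cnj w * z) \<le> 1 + cmod w * cmod z"
    using norm_triangle_ineq4[of 1 "cnj w * z"] by (simp add: norm_mult)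
  also have "cmod w * cmod z \<le> 1"
    using assms by (simp add: mult_le_one)
  finally have "(cmod (1 - cnj w * z))\<^sup>2 \<le> 2\<^sup>2"
    by (intro power_mono) auto
  moreover have "1 - cmod z \<le> 1 - (cmod z)\<^sup>2" "1 - cmod w \<le> 1 - (cmod w)\<^sup>2"
    using assms by (auto simp: power2_eq_square mult_left_le)
  ultimately have "(1 - cmod z) * (1 - cmod w) / 4 \<le>
      (1 - (cmod z)\<^sup>2) * (1 - (cmod w)\<^sup>2) / (cmod (1 - cnj w * z))\<^sup>2"
    using assms one_minus_cnj_mult_nonzero[OF assms]
    by (intro frac_le mult_mono) (auto simp: abs_square_le_1)
  then show ?thesis
    by (simp add: one_minus_norm_blaschke_factor_sq[OF assms] mult.commute)
qed

subsection \<open>Bounded holomorphic functions on the disc\<close>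

text \<open>This is the identity theorem. The witness \<beta> is the form in which "not identically
  zero" is carried through the development.\<close>

lemma eventually_nonzero_in_disc:
  assumes "f holomorphic_on ball 0 1" "\<beta> \<in> ball 0 1" "f \<beta> \<noteq> 0" "z \<in> ball 0 1"
  shows "eventually (\<lambda>w. f w \<noteq> 0) (at z)"
  using non_zero_neighbour_alt[OF assms(1) open_ball connected_ball assms(4,2,3)]
  by (auto elim: eventually_mono)

lemma holomorphic_imp_analytic_in_disc:
  assumes "f holomorphic_on ball 0 1" "z \<in> ball 0 1"
  shows "f analytic_on {z}"
  using assms holomorphic_on_imp_analytic_at open_ball by blast

lemma zorder_mult_in_disc:
  assumes "f holomorphic_on ball 0 1" "g holomorphic_on ball 0 1"
    and "\<beta> \<in> ball 0 1" "f \<beta> * g \<beta> \<noteq> 0" "z \<in> ball 0 1"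
  shows "zorder (\<lambda>w. f w * g w) z = zorder f z + zorder g z"
  using assms
  by (intro zorder_times_analytic holomorphic_imp_analytic_in_disc
        eventually_nonzero_in_disc[of _ \<beta>] holomorphic_intros)

lemma zorder_cong_in_disc:
  assumes "\<And>w. w \<in> ball 0 1 \<Longrightarrow> f w = g w" "z \<in> ball 0 1"
  shows "zorder f z = zorder g z"
proof (rule zorder_cong)
  have "eventually (\<lambda>w. w \<in> ball 0 1) (at z)"
    using assms(2) by (intro eventually_at_in_open') auto
  then show "eventually (\<lambda>w. f w = g w) (at z)"
    by eventually_elim (rule assms(1))
qed auto

lemma zorder_nonneg_in_disc:
  assumes "f holomorphic_on ball 0 1" "\<beta> \<in> ball 0 1" "f \<beta> \<noteq> 0" "z \<in> ball 0 1"
  shows "zorder f z \<ge> 0" and "zorder f z = 0 \<longleftrightarrow> f z \<noteq> 0"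
proof -
  have *: "f analytic_on {z}" "frequently (\<lambda>w. f w \<noteq> 0) (at z)"
    using holomorphic_imp_analytic_in_disc eventually_nonzero_in_disc[OF assms] assms
    by (auto intro: eventually_frequently)
  show "zorder f z \<ge> 0" using * by (rule zorder_ge_0)
  show "zorder f z = 0 \<longleftrightarrow> f z \<noteq> 0" using * by (rule zorder_eq_0_iff)
qed

text \<open>The quotient is bounded by \<open>1\<close>, so its singularities at the zeros of
  \<open>h\<close> are removable.\<close>

lemma holomorphic_division:
  assumes f: "f holomorphic_on ball 0 1" and h: "h holomorphic_on ball 0 1"
    and \<beta>: "\<beta> \<in> ball 0 1" "h \<beta> \<noteq> 0"
    and le: "\<And>z. z \<in> ball 0 1 \<Longrightarrow> cmod (f z) \<le> cmod (h z)"
  obtains g where "g holomorphic_on ball 0 1"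
    "\<And>z. z \<in> ball 0 1 \<Longrightarrow> f z = h z * g z" "\<And>z. z \<in> ball 0 1 \<Longrightarrow> cmod (g z) \<le> 1"
proof -
  define q where "q = (\<lambda>z. f z / h z)"
  have an: "f analytic_on {z}" "h analytic_on {z}" if "z \<in> ball 0 1" for z
    using f h that holomorphic_imp_analytic_in_disc by blast+
  \<comment> \<open>At a zero of \<open>h\<close> division by zero gives \<open>q z = 0\<close>, so
    the bound holds there too.\<close>
  have q1: "cmod (q z) \<le> 1" if "z \<in> ball 0 1" for z
    using le[OF that] by (cases "h z = 0") (auto simp: q_def norm_divide)
  have iso: "isolated_singularity_at q z" and ness: "not_essential q z" if "z \<in> ball 0 1" for z
    unfolding q_def
    by (intro isolated_singularity_at_divide not_essential_divide
        not_essential_analytic isolated_singularity_at_analytic an that)+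
  have lim: "\<exists>c. q \<midarrow>z\<rightarrow> c \<and> cmod c \<le> 1" if z: "z \<in> ball 0 1" for z
  proof -
    have ev: "eventually (\<lambda>w. cmod (q w) \<le> 1) (at z)"
    proof -
      have "eventually (\<lambda>w. w \<in> ball 0 1) (at z)"
        using z by (intro eventually_at_in_open') auto
      then show ?thesis by eventually_elim (rule q1)
    qed
    have "\<not> is_pole q z"
    proof
      assume "is_pole q z"
      then have "eventually (\<lambda>w. cmod (q w) \<ge> 2) (at z)"
        by (simp add: is_pole_def filterlim_at_infinity[of 0])
      with ev have "eventually (\<lambda>w. False) (at z)"
        by eventually_elim auto
      then show False by simp
    qed
    then obtain c where c: "q \<midarrow>z\<rightarrow> c"
      using ness[OF z] by (auto simp: not_essential_def)
    moreover have "cmod c \<le> 1"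
      using tendsto_upperbound[OF tendsto_norm[OF c] ev] by simp
    ultimately show ?thesis by blast
  qed
  define g where "g = remove_sings q"
  have g1: "cmod (g z) \<le> 1" if "z \<in> ball 0 1" for z
    using lim[OF that] by (auto simp: g_def dest: remove_sings_eqI)
  have gan: "g analytic_on {z}" if "z \<in> ball 0 1" for z
    using lim[OF that] iso[OF that] remove_sings_analytic_at by (auto simp: g_def)
  then have "g analytic_on ball 0 1"
    using analytic_on_analytic_at by blast
  then have ghol: "g holomorphic_on ball 0 1"
    by (rule analytic_imp_holomorphic)
  have "f z = h z * g z" if z: "z \<in> ball 0 1" for z
  proof -
    \<comment> \<open>The zeros of \<open>h\<close> are isolated, so the identity holds in a
      punctured neighbourhood of \<open>z\<close> and passes to \<open>z\<close> by
      continuity.\<close>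
    have "eventually (\<lambda>w. f w = h w * g w) (at z)"
      using eventually_remove_sings_eq_at[OF iso[OF z]] eventually_nonzero_in_disc[OF h \<beta> z]
      by eventually_elim (auto simp: g_def q_def)
    then have "(\<lambda>w. h w * g w) \<midarrow>z\<rightarrow> f z"
      using analytic_at_imp_isCont[OF an(1)[OF z]]
      by (auto simp: isCont_def elim: Lim_transform_eventually)
    moreover have "(\<lambda>w. h w * g w) \<midarrow>z\<rightarrow> h z * g z"
      using analytic_at_imp_isCont[OF an(2)[OF z]] analytic_at_imp_isCont[OF gan[OF z]]
      by (auto simp: isCont_def intro: tendsto_mult)
    ultimately show ?thesis
      by (rule tendsto_unique[OF at_neq_bot])
  qed
  with ghol g1 that show ?thesis by blast
qed

text \<open>Schwarz-Pick: a disc automorphism moves \<open>w\<close> to \<open>0\<close>, where the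
  Schwarz lemma applies.\<close>

lemma norm_le_norm_blaschke_factor:
  assumes f: "f holomorphic_on ball 0 1" and le1: "\<And>z. z \<in> ball 0 1 \<Longrightarrow> cmod (f z) \<le> 1"
    and w: "cmod w < 1" "f w = 0" and z: "cmod z < 1"
  shows "cmod (f z) \<le> cmod (blaschke_factor w z)"
proof -
  define F where "F = f \<circ> Moebius_function 0 (- w)"
  have M: "Moebius_function 0 (- w) \<zeta> \<in> ball 0 1" if "cmod \<zeta> < 1" for \<zeta>
    using Moebius_function_norm_lt_1[of "- w" \<zeta>] w that by simp
  have F0: "F 0 = 0"
    using w by (simp add: F_def Moebius_function_of_zero)
  have F: "F holomorphic_on ball 0 1"
    unfolding F_def
    using M w by (intro holomorphic_on_compose_gen[OF Moebius_function_holomorphic f]) auto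
  have F1: "cmod (F \<zeta>) \<le> 1" if "cmod \<zeta> < 1" for \<zeta>
    using le1[OF M[OF that]] by (simp add: F_def)
  \<comment> \<open>The Schwarz lemma asks for a strict bound. Modulus \<open>1\<close> at an
    interior point would make \<open>F\<close> constant, contradicting
    \<open>F 0 = 0\<close>.\<close>
  have F_less: "cmod (F \<zeta>) < 1" if \<zeta>: "cmod \<zeta> < 1" for \<zeta>
  proof (rule ccontr)
    assume "\<not> cmod (F \<zeta>) < 1"
    then have 1: "cmod (F \<zeta>) = 1" using F1[OF \<zeta>] by simp
    have "F constant_on ball 0 1"
      using \<zeta> F1 1
      by (intro maximum_modulus_principle[OF F open_ball connected_ball open_ball order_refl, of \<zeta>]) auto
    then show False
      using F0 1 \<zeta> unfolding constant_on_def
      by (metis centre_in_ball mem_ball_0 norm_zero zero_less_one zero_neq_one)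
  qed
  define \<zeta> where "\<zeta> = Moebius_function 0 w z"
  have \<zeta>: "cmod \<zeta> < 1"
    unfolding \<zeta>_def by (rule Moebius_function_norm_lt_1) (use w z in auto)
  have "F \<zeta> = f z"
    using w z by (simp add: F_def \<zeta>_def Moebius_function_compose)
  moreover have "cmod (F \<zeta>) \<le> cmod \<zeta>"
    by (rule Schwarz_Lemma(1)[OF F F0 F_less \<zeta>])
  moreover have "cmod \<zeta> = cmod (blaschke_factor w z)"
    by (simp add: \<zeta>_def Moebius_function_simple norm_blaschke_factor norm_divide norm_minus_commute)
  ultimately show ?thesis by simp
qed

lemma zorder_blaschke_factor:
  assumes "cmod w < 1" "cmod z < 1"
  shows "zorder (blaschke_factor w) z = (if z = w then 1 else 0)"
proof (cases "z = w")
  case True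
  then show ?thesis using zorder_blaschke_factor_self[OF assms(1)] by simp
next
  case False
  then show ?thesis
    using blaschke_factor_holomorphic[OF assms(1)] blaschke_factor_eq_0_iff[OF assms] assms
    by (auto intro!: zorder_eq_0I holomorphic_imp_analytic_in_disc)
qed

text \<open>The factors are divided out one at a time; each division lowers the order at the
  corresponding zero by one. The multiplicity condition is an inequality, so that \<open>w\<close>
  may list only some of the zeros.\<close>

lemma norm_le_prod_blaschke_factor:
  assumes "finite F" "f holomorphic_on ball 0 1" "\<And>z. z \<in> ball 0 1 \<Longrightarrow> cmod (f z) \<le> 1"
    and "\<beta> \<in> ball 0 1" "f \<beta> \<noteq> 0"
    and "\<And>n. n \<in> F \<Longrightarrow> cmod (w n) < 1"
    and "\<And>z. z \<in> ball 0 1 \<Longrightarrow> int (card {n \<in> F. w n = z}) \<le> zorder f z"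
    and "z \<in> ball 0 1"
  shows "cmod (f z) \<le> (\<Prod>n\<in>F. cmod (blaschke_factor (w n) z))"
  using assms
proof (induction F arbitrary: f rule: finite_induct)
  case (insert x F)
  define h where "h = blaschke_factor (w x)"
  have wx: "cmod (w x) < 1" using insert.prems by auto
  have h: "h holomorphic_on ball 0 1"
    unfolding h_def by (rule blaschke_factor_holomorphic[OF wx])
  have "f (w x) = 0"
  proof -
    have "{n \<in> insert x F. w n = w x} \<noteq> {}" "finite {n \<in> insert x F. w n = w x}"
      using insert.hyps by auto
    then have "card {n \<in> insert x F. w n = w x} > 0"
      by (simp add: card_gt_0_iff)
    then have "zorder f (w x) \<noteq> 0"
      using insert.prems(6)[of "w x"] wx by simp
    then show ?thesis
      using zorder_nonneg_in_disc(2)[OF insert.prems(1,3,4), of "w x"] wx by simp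
  qed
  then have le: "cmod (f z) \<le> cmod (h z)" if "z \<in> ball 0 1" for z
    unfolding h_def
    using that wx insert.prems(2)
    by (intro norm_le_norm_blaschke_factor[OF insert.prems(1)]) auto
  then have "h \<beta> \<noteq> 0"
    using insert.prems(3,4) by fastforce
  then obtain g where g: "g holomorphic_on ball 0 1" "\<And>z. z \<in> ball 0 1 \<Longrightarrow> f z = h z * g z"
    "\<And>z. z \<in> ball 0 1 \<Longrightarrow> cmod (g z) \<le> 1"
    using holomorphic_division[OF insert.prems(1) h insert.prems(3) _ le] by metis
  have g\<beta>: "g \<beta> \<noteq> 0" using g(2) insert.prems(3,4) by force
  have "cmod (g z) \<le> (\<Prod>n\<in>F. cmod (blaschke_factor (w n) z))"
  proof (rule insert.IH[OF g(1,3) insert.prems(3) g\<beta> _ _ insert.prems(7)])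
    fix y :: complex assume y: "y \<in> ball 0 1"
    have "zorder f y = zorder (\<lambda>z. h z * g z) y"
      using g(2) y by (intro zorder_cong_in_disc)
    also have "\<dots> = zorder h y + zorder g y"
      using \<open>h \<beta> \<noteq> 0\<close> g\<beta> y insert.prems(3) by (intro zorder_mult_in_disc[OF h g(1), of \<beta>]) auto
    also have "zorder h y = (if y = w x then 1 else 0)"
      unfolding h_def using wx y by (intro zorder_blaschke_factor) auto
    finally have "int (card {n \<in> insert x F. w n = y}) \<le> (if y = w x then 1 else 0) + zorder g y"
      using insert.prems(6)[OF y] by simp
    moreover have "{n \<in> insert x F. w n = y} =
        (if y = w x then insert x {n \<in> F. w n = y} else {n \<in> F. w n = y})"
      by auto
    ultimately show "int (card {n \<in> F. w n = y}) \<le> zorder g y"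
      using insert.hyps by (auto split: if_splits)
  qed (use insert.prems in auto)
  then show ?case
    using insert.hyps g(2)[OF insert.prems(7)]
    by (simp add: norm_mult h_def mult_left_mono)
qed auto

text \<open>
  With \<open>g = exp h\<close>, the map \<open>(h - h p) / (h + cnj (h p) - 2)\<close> sends the disc into itself and
  vanishes at \<open>p\<close>; the shift by \<open>1\<close> of \<open>h\<close> only serves to make its real part strictly negative.
\<close>
lemma harnack_zero_free:
  assumes g: "g holomorphic_on ball 0 1" and g1: "\<And>z. z \<in> ball 0 1 \<Longrightarrow> cmod (g z) \<le> 1"
    and g0: "\<And>z. z \<in> ball 0 1 \<Longrightarrow> g z \<noteq> 0"
    and p: "cmod p < 1" and z: "cmod z < 1"
    and \<rho>: "cmod (blaschke_factor p z) \<le> \<rho>" "\<rho> < 1"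
  shows "- ln (cmod (g z)) \<le> 4 * (1 - ln (cmod (g p))) / (1 - \<rho>\<^sup>2)"
proof -
  obtain h where h: "h holomorphic_on ball 0 1" "\<And>z. z \<in> ball 0 1 \<Longrightarrow> g z = exp (h z)"
    using simply_connected_imp_holomorphic_log[OF g _ _ g0]
    by (metis convex_ball convex_imp_simply_connected convex_imp_locally_path_connected)
  have Re_h: "Re (h z) = ln (cmod (g z))" if "z \<in> ball 0 1" for z
    using h(2)[OF that] by simp
  have Re_h_le: "Re (h z) \<le> 0" if "z \<in> ball 0 1" for z
    using g1[OF that] g0[OF that] Re_h[OF that] by (simp add: ln_le_zero_iff)
  define D where "D = (\<lambda>u. h u + cnj (h p) - 2)"
  define X Y where "X = 1 - Re (h z)" and "Y = 1 - Re (h p)"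
  have XY: "X \<ge> 1" "Y \<ge> 1" using Re_h_le[of z] Re_h_le[of p] p z by (auto simp: X_def Y_def)
  \<comment> \<open>This is \<open>|H u + cnj (H p)|^2 - |H u - H p|^2 = 4 * Re (H u) * Re (H
    p)\<close> for \<open>H = h - 1\<close>. It yields both the bound on \<phi> and the final
    estimate.\<close>
  have D: "(cmod (D u))\<^sup>2 - (cmod (h u - h p))\<^sup>2 = 4 * (1 - Re (h u)) * Y" for u
    unfolding cmod_power2 D_def Y_def by (simp add: power2_eq_square algebra_simps)
  have D_ge: "cmod (D u) \<ge> 2" if "u \<in> ball 0 1" for u
    using abs_Re_le_cmod[of "D u"] Re_h_le[OF that] Re_h_le[of p] p by (auto simp: D_def)
  have D_nz: "D u \<noteq> 0" if "u \<in> ball 0 1" for u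
    using D_ge[OF that] by auto
  define \<phi> where "\<phi> = (\<lambda>u. (h u - h p) / D u)"
  have "\<phi> holomorphic_on ball 0 1"
    unfolding \<phi>_def using D_nz unfolding D_def by (intro holomorphic_intros h) auto
  moreover have "cmod (\<phi> u) \<le> 1" if u: "u \<in> ball 0 1" for u
  proof -
    have "4 * (1 - Re (h u)) * Y \<ge> 0"
      using Re_h_le[OF u] XY by simp
    then have "(cmod (h u - h p))\<^sup>2 \<le> (cmod (D u))\<^sup>2"
      using D[of u] by linarith
    then have "cmod (h u - h p) \<le> cmod (D u)"
      by (rule power2_le_imp_le) simp
    then show ?thesis by (simp add: \<phi>_def norm_divide divide_le_eq_1)
  qed
  moreover have "\<phi> p = 0" by (simp add: \<phi>_def)
  ultimately have "cmod (\<phi> z) \<le> cmod (blaschke_factor p z)"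
    using p z by (intro norm_le_norm_blaschke_factor)
  with \<rho> have "cmod (\<phi> z) \<le> \<rho>" by simp
  then have "cmod (h z - h p) \<le> \<rho> * cmod (D z)"
    using D_nz[of z] z by (simp add: \<phi>_def norm_divide divide_le_eq)
  then have "(cmod (h z - h p))\<^sup>2 \<le> \<rho>\<^sup>2 * (cmod (D z))\<^sup>2"
    by (metis norm_ge_zero power_mono power_mult_distrib)
  then have "(1 - \<rho>\<^sup>2) * (cmod (D z))\<^sup>2 \<le> 4 * X * Y"
    using D[of z] by (simp add: X_def algebra_simps)
  moreover have \<rho>2: "\<rho>\<^sup>2 < 1"
    using \<rho> order_trans[OF norm_ge_zero \<rho>(1)] by (simp add: abs_square_less_1)
  \<comment> \<open>The real part of \<open>D z\<close> is \<open>-(X + Y)\<close>. One factor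
    \<open>X\<close> then cancels, leaving a bound linear in \<open>Y\<close>.\<close>
  moreover have "X \<le> cmod (D z)"
    using abs_Re_le_cmod[of "D z"] XY by (auto simp: D_def X_def Y_def)
  then have "X\<^sup>2 \<le> (cmod (D z))\<^sup>2"
    using XY by (intro power_mono) auto
  ultimately have "(1 - \<rho>\<^sup>2) * X\<^sup>2 \<le> 4 * X * Y"
    by (smt (verit) mult_left_mono)
  then have "X * ((1 - \<rho>\<^sup>2) * X) \<le> X * (4 * Y)"
    by (simp add: power2_eq_square algebra_simps)
  then have "(1 - \<rho>\<^sup>2) * X \<le> 4 * Y"
    using XY by (simp add: mult_le_cancel_left)
  then have "X \<le> 4 * Y / (1 - \<rho>\<^sup>2)"
    using \<rho>2 by (simp add: field_simps)
  then show ?thesis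
    using Re_h[of z] Re_h[of p] p z by (simp add: X_def Y_def)
qed

subsection \<open>Blaschke products\<close>

definition bprod :: "nat set \<Rightarrow> (nat \<Rightarrow> complex) \<Rightarrow> complex \<Rightarrow> complex" where
  "bprod I w z = prodinf (\<lambda>n. if n \<in> I then blaschke_factor (w n) z else 1)"

lemma blaschke_sequence_subset:
  "blaschke_sequence I w \<Longrightarrow> J \<subseteq> I \<Longrightarrow> blaschke_sequence J w"
  unfolding blaschke_sequence_def by (auto intro: summable_on_subset_banach)

lemma blaschke_sequence_norm: "blaschke_sequence I w \<Longrightarrow> n \<in> I \<Longrightarrow> cmod (w n) < 1"
  unfolding blaschke_sequence_def by auto

lemma blaschke_sequence_summable:
  assumes "blaschke_sequence I w"
  shows "summable (\<lambda>n. if n \<in> I then 1 - cmod (w n) else 0)"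
proof -
  have "(\<lambda>n. if n \<in> I then 1 - cmod (w n) else 0) summable_on UNIV \<longleftrightarrow>
        (\<lambda>n. 1 - cmod (w n)) summable_on I"
    by (rule summable_on_cong_neutral) auto
  then have "(\<lambda>n. if n \<in> I then 1 - cmod (w n) else 0) summable_on UNIV"
    using assms by (simp add: blaschke_sequence_def)
  then show ?thesis
    by (rule summable_on_imp_summable)
qed

text \<open>On \<open>|z| \<le> r\<close> the \<open>n\<close>-th factor differs from
  \<open>1\<close> by at most \<open>2 * (1 - |w n|) / (1 - r)\<close>, so the Weierstrass test
  gives locally uniform convergence, from which both claims follow.\<close>

lemma
  assumes "blaschke_sequence I w"
  shows bprod_has_prod: "\<And>z. z \<in> ball 0 1 \<Longrightarrow>
          (\<lambda>n. if n \<in> I then blaschke_factor (w n) z else 1) has_prod bprod I w z"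
    and bprod_holomorphic: "bprod I w holomorphic_on ball 0 1"
proof -
  define f where "f = (\<lambda>n z. if n \<in> I then blaschke_factor (w n) z else 1)"
  define c where "c = (\<lambda>n. if n \<in> I then 1 - cmod (w n) else 0)"
  have c: "summable c"
    unfolding c_def by (rule blaschke_sequence_summable[OF assms])
  have f_hol: "f n holomorphic_on ball 0 1" for n
    using blaschke_factor_holomorphic[OF blaschke_sequence_norm[OF assms]]
    by (cases "n \<in> I") (auto simp: f_def[abs_def])
  have le: "norm (f n z - 1) \<le> 2 / (1 - r) * c n" if "cmod z \<le> r" "r < 1" for n z r
  proof (cases "n \<in> I")
    case True
    have wn: "cmod (w n) < 1" by (rule blaschke_sequence_norm[OF assms True])
    have "norm (f n z - 1) \<le> 2 * (1 - cmod (w n)) / (1 - cmod z)"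
      using norm_blaschke_factor_minus_1_le[OF wn, of z] that True by (simp add: f_def)
    also have "\<dots> \<le> 2 * (1 - cmod (w n)) / (1 - r)"
      using wn that by (intro divide_left_mono mult_pos_pos) auto
    finally show ?thesis using True by (simp add: c_def)
  qed (simp add: f_def c_def)
  have conv: "convergent_prod (\<lambda>n. f n z)" if "z \<in> ball 0 1" for z
  proof -
    have "summable (\<lambda>n. norm (f n z - 1))"
    proof (rule summable_comparison_test')
      show "summable (\<lambda>n. 2 / (1 - cmod z) * c n)" using c by (rule summable_mult)
      show "norm (norm (f n z - 1)) \<le> 2 / (1 - cmod z) * c n" if "n \<ge> 0" for n
        using le[of z "cmod z" n] \<open>z \<in> ball 0 1\<close> by simp
    qed
    then show ?thesis
      using abs_convergent_prod_conv_summable abs_convergent_prod_imp_convergent_prod by blast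
  qed
  have bp: "bprod I w z = prodinf (\<lambda>n. f n z)" for z
    by (simp add: bprod_def f_def)
  show hp: "(\<lambda>n. if n \<in> I then blaschke_factor (w n) z else 1) has_prod bprod I w z"
    if "z \<in> ball 0 1" for z
    using convergent_prod_has_prod[OF conv[OF that]] unfolding bp by (simp add: f_def)
  show "bprod I w holomorphic_on ball 0 1"
  proof (rule holomorphic_uniform_sequence)
    show "(\<lambda>z. \<Prod>k<n. f k z) holomorphic_on ball 0 1" for n
      by (intro holomorphic_intros f_hol)
    fix x :: complex assume x: "x \<in> ball 0 1"
    define d where "d = (1 - cmod x) / 2"
    have d: "d > 0" "cmod x + d < 1" using x by (auto simp: d_def field_simps)
    have sub: "cmod z \<le> cmod x + d" if "z \<in> cball x d" for z
      using that norm_triangle_ineq[of x "z - x"] by (simp add: dist_norm norm_minus_commute)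
    then have sub': "cball x d \<subseteq> ball 0 1" using d by force
    have "uniform_limit (cball x d) (\<lambda>N z. \<Sum>n<N. norm (f n z - 1))
            (\<lambda>z. \<Sum>n. norm (f n z - 1)) sequentially"
    proof (rule Weierstrass_m_test)
      show "summable (\<lambda>n. 2 / (1 - (cmod x + d)) * c n)" using c by (rule summable_mult)
      show "norm (norm (f n z - 1)) \<le> 2 / (1 - (cmod x + d)) * c n" if "z \<in> cball x d" for n z
        using le[OF sub[OF that] d(2)] by simp
    qed
    then have "uniformly_convergent_on (cball x d) (\<lambda>N z. \<Prod>n<N. f n z)"
      using sub' f_hol
      by (intro uniformly_convergent_on_prod')
         (auto simp: uniformly_convergent_on_def intro: holomorphic_on_imp_continuous_on holomorphic_on_subset)
    then obtain l where l: "uniform_limit (cball x d) (\<lambda>N z. \<Prod>n<N. f n z) l sequentially"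
      by (auto simp: uniformly_convergent_on_def)
    have "l z = bprod I w z" if z: "z \<in> cball x d" for z
    proof (rule LIMSEQ_unique)
      show "(\<lambda>N. \<Prod>n<N. f n z) \<longlonglongrightarrow> l z" by (rule tendsto_uniform_limitI[OF l z])
      show "(\<lambda>N. \<Prod>n<N. f n z) \<longlonglongrightarrow> bprod I w z"
        using has_prod_imp_tendsto'[OF hp[of z]] z sub' by (auto simp: f_def)
    qed
    then have "uniform_limit (cball x d) (\<lambda>N z. \<Prod>n<N. f n z) (bprod I w) sequentially"
      using l by (subst uniform_limit_cong'[where g = "\<lambda>N z. \<Prod>n<N. f n z" and i = l]) auto
    then show "\<exists>d>0. cball x d \<subseteq> ball 0 1 \<and>
        uniform_limit (cball x d) (\<lambda>N z. \<Prod>n<N. f n z) (bprod I w) sequentially"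
      using d sub' by blast
  qed auto
qed

lemma bprod_split:
  assumes w: "blaschke_sequence I w" and F: "finite F" "F \<subseteq> I" and z: "z \<in> ball 0 1"
  shows "bprod I w z = (\<Prod>n\<in>F. blaschke_factor (w n) z) * bprod (I - F) w z"
proof (rule has_prod_unique2)
  show "(\<lambda>n. if n \<in> I then blaschke_factor (w n) z else 1) has_prod bprod I w z"
    by (rule bprod_has_prod[OF w z])
  have "(\<lambda>n. (if n \<in> F then blaschke_factor (w n) z else 1) *
             (if n \<in> I - F then blaschke_factor (w n) z else 1)) has_prod
        ((\<Prod>n\<in>F. blaschke_factor (w n) z) * bprod (I - F) w z)"
    by (intro has_prod_mult has_prod_If_finite_set F bprod_has_prod[OF _ z]
          blaschke_sequence_subset[OF w]) auto
  also have "(\<lambda>n. (if n \<in> F then blaschke_factor (w n) z else 1) *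
             (if n \<in> I - F then blaschke_factor (w n) z else 1)) =
             (\<lambda>n. if n \<in> I then blaschke_factor (w n) z else 1)"
    using F by (intro ext) auto
  finally show "(\<lambda>n. if n \<in> I then blaschke_factor (w n) z else 1) has_prod
        ((\<Prod>n\<in>F. blaschke_factor (w n) z) * bprod (I - F) w z)" .
qed

lemma bprod_eq_0_iff:
  assumes w: "blaschke_sequence I w" and z: "z \<in> ball 0 1"
  shows "bprod I w z = 0 \<longleftrightarrow> (\<exists>n\<in>I. w n = z)"
proof -
  have "blaschke_factor (w n) z = 0 \<longleftrightarrow> w n = z" if "n \<in> I" for n
    using blaschke_factor_eq_0_iff[OF blaschke_sequence_norm[OF w that]] z by auto
  then show ?thesis
    using has_prod_eq_0_iff[OF bprod_has_prod[OF w z]]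
    by (auto simp: image_iff split: if_splits)
qed

lemma bprod_tendsto_norm:
  assumes w: "blaschke_sequence I w" and z: "z \<in> ball 0 1"
  shows "(\<lambda>N. \<Prod>n\<in>I \<inter> {..N}. cmod (blaschke_factor (w n) z)) \<longlonglongrightarrow> cmod (bprod I w z)"
proof -
  have "(\<lambda>N. cmod (\<Prod>n\<le>N. if n \<in> I then blaschke_factor (w n) z else 1)) \<longlonglongrightarrow> cmod (bprod I w z)"
    by (intro tendsto_norm has_prod_imp_tendsto bprod_has_prod[OF w z])
  moreover have "cmod (\<Prod>n\<le>N. if n \<in> I then blaschke_factor (w n) z else 1) =
      (\<Prod>n\<in>I \<inter> {..N}. cmod (blaschke_factor (w n) z))" for N
    by (simp add: prod_norm[symmetric] prod.inter_restrict[symmetric] Int_commute if_distrib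
        cong: if_cong)
  ultimately show ?thesis by simp
qed

lemma norm_bprod_le_1:
  assumes w: "blaschke_sequence I w" and z: "z \<in> ball 0 1"
  shows "cmod (bprod I w z) \<le> 1"
proof (rule LIMSEQ_le_const2[OF bprod_tendsto_norm[OF w z]])
  have "cmod (blaschke_factor (w n) z) \<le> 1" if "n \<in> I" for n
    using norm_blaschke_factor_less_1[OF blaschke_sequence_norm[OF w that], of z] z by simp
  then show "\<exists>N. \<forall>n\<ge>N. (\<Prod>n\<in>I \<inter> {..n}. cmod (blaschke_factor (w n) z)) \<le> 1"
    by (intro exI allI impI prod_le_1) auto
qed

text \<open>Weierstrass' inequality: the product of the \<open>1 - x n\<close> is at least
  \<open>1\<close> minus the sum of the \<open>x n\<close>, applied to finite partial products with
  \<open>1 - x n\<close> the squared modulus of a factor.\<close>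

lemma one_minus_norm_bprod_sq_le:
  assumes w: "blaschke_sequence I w" and z: "z \<in> ball 0 1"
    and S: "\<And>F. finite F \<Longrightarrow> F \<subseteq> I \<Longrightarrow> (\<Sum>n\<in>F. 1 - (cmod (blaschke_factor (w n) z))\<^sup>2) \<le> S"
  shows "1 - (cmod (bprod I w z))\<^sup>2 \<le> S"
proof -
  have 1: "cmod (blaschke_factor (w n) z) \<le> 1" if "n \<in> I" for n
    using norm_blaschke_factor_less_1[OF blaschke_sequence_norm[OF w that], of z] z by simp
  have "1 - S \<le> (\<Prod>n\<in>I \<inter> {..N}. cmod (blaschke_factor (w n) z))\<^sup>2" for N
  proof -
    have "1 - S \<le> 1 - (\<Sum>n\<in>I \<inter> {..N}. 1 - (cmod (blaschke_factor (w n) z))\<^sup>2)"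
      using S[of "I \<inter> {..N}"] by simp
    also have "\<dots> \<le> (\<Prod>n\<in>I \<inter> {..N}. 1 - (1 - (cmod (blaschke_factor (w n) z))\<^sup>2))"
      using 1 by (intro Weierstrass_prod_ineq) (auto simp: abs_square_le_1)
    also have "\<dots> = (\<Prod>n\<in>I \<inter> {..N}. cmod (blaschke_factor (w n) z))\<^sup>2"
      by (simp add: prod_power_distrib)
    finally show ?thesis .
  qed
  then have "1 - S \<le> (cmod (bprod I w z))\<^sup>2"
    by (intro LIMSEQ_le_const[OF tendsto_power[OF bprod_tendsto_norm[OF w z]]]) auto
  then show ?thesis by simp
qed

lemma blaschke_sequence_finite_in_cball:
  assumes w: "blaschke_sequence I w" and r: "r < 1"
  shows "finite {n \<in> I. cmod (w n) \<le> r}"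
proof -
  have "eventually (\<lambda>n. (if n \<in> I then 1 - cmod (w n) else 0) < 1 - r) sequentially"
    using summable_LIMSEQ_zero[OF blaschke_sequence_summable[OF w]] r
    by (intro order_tendstoD) auto
  then obtain N where N: "\<And>n. n \<ge> N \<Longrightarrow> (if n \<in> I then 1 - cmod (w n) else 0) < 1 - r"
    by (auto simp: eventually_sequentially)
  have "n < N" if "n \<in> I" "cmod (w n) \<le> r" for n
    using N[of n] that by (cases "n < N") auto
  then have "{n \<in> I. cmod (w n) \<le> r} \<subseteq> {..<N}" by auto
  then show ?thesis by (rule finite_subset) simp
qed

text \<open>The zeros form a countable set, while the disc is uncountable.\<close>

lemma bprod_not_identically_0:
  assumes w: "blaschke_sequence I w"
  obtains \<beta> where "\<beta> \<in> ball 0 1" "bprod I w \<beta> \<noteq> 0"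
proof -
  have "uncountable (ball (0::complex) 1)" by (rule uncountable_ball) simp
  moreover have "countable (w ` I)" by auto
  ultimately obtain \<beta> where "\<beta> \<in> ball 0 1" "\<beta> \<notin> w ` I"
    by (meson countable_subset subsetI)
  then show ?thesis using that bprod_eq_0_iff[OF w] by blast
qed

text \<open>Only finitely many indices carry the value \<open>z\<close>. Splitting them off leaves a
  product that does not vanish at \<open>z\<close>, and each removed factor has a simple zero
  there.\<close>

lemma zorder_bprod:
  assumes w: "blaschke_sequence I w" and z: "z \<in> ball 0 1"
  shows "zorder (bprod I w) z = int (card {n \<in> I. w n = z})"
proof -
  define F where "F = {n \<in> I. w n = z}"
  define P where "P = (\<lambda>z. \<Prod>n\<in>F. blaschke_factor (w n) z)"
  have F: "finite F" "F \<subseteq> I"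
    using blaschke_sequence_finite_in_cball[OF w, of "cmod z"] z
    by (auto simp: F_def elim: rev_finite_subset)
  have w': "blaschke_sequence (I - F) w" by (rule blaschke_sequence_subset[OF w]) auto
  have wn: "blaschke_factor (w n) holomorphic_on ball 0 1" if "n \<in> I" for n
    by (rule blaschke_factor_holomorphic[OF blaschke_sequence_norm[OF w that]])
  have P: "P holomorphic_on ball 0 1"
    unfolding P_def using wn F by (intro holomorphic_intros) auto
  obtain \<beta> where \<beta>: "\<beta> \<in> ball 0 1" "bprod I w \<beta> \<noteq> 0"
    using bprod_not_identically_0[OF w] .
  have split: "bprod I w u = P u * bprod (I - F) w u" if "u \<in> ball 0 1" for u
    unfolding P_def by (rule bprod_split[OF w F that])
  have "zorder (bprod I w) z = zorder (\<lambda>u. P u * bprod (I - F) w u) z"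
    using split z by (intro zorder_cong_in_disc)
  also have "\<dots> = zorder P z + zorder (bprod (I - F) w) z"
    using \<beta> split[OF \<beta>(1)] by (intro zorder_mult_in_disc[OF P bprod_holomorphic[OF w'] \<beta>(1) _ z]) auto
  also have "zorder (bprod (I - F) w) z = 0"
    using bprod_eq_0_iff[OF w' z] bprod_holomorphic[OF w'] z
    by (intro zorder_eq_0I holomorphic_imp_analytic_in_disc) (auto simp: F_def)
  also have "zorder P z = (\<Sum>n\<in>F. zorder (blaschke_factor (w n)) z)"
    unfolding P_def
  proof (rule zorder_prod_analytic)
    show "blaschke_factor (w n) analytic_on {z}" if "n \<in> F" for n
      using that F by (intro holomorphic_imp_analytic_in_disc[OF wn z]) auto
    have "P \<beta> \<noteq> 0" using \<beta> split by auto
    then show "eventually (\<lambda>z. (\<Prod>n\<in>F. blaschke_factor (w n) z) \<noteq> 0) (at z)"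
      using eventually_nonzero_in_disc[OF P \<beta>(1) _ z] by (simp add: P_def)
  qed
  also have "\<dots> = (\<Sum>n\<in>F. 1)"
    using z by (intro sum.cong) (auto simp: F_def zorder_blaschke_factor_self)
  finally show ?thesis by (simp add: F_def)
qed

lemma blaschke_product_bprod: "blaschke_sequence I w \<Longrightarrow> blaschke_product (bprod I w)"
  unfolding blaschke_product_def using bprod_has_prod by blast

lemma blaschke_productE:
  assumes "blaschke_product B"
  obtains I w where "blaschke_sequence I w" "\<And>z. z \<in> ball 0 1 \<Longrightarrow> B z = bprod I w z"
  using assms bprod_has_prod has_prod_unique2 unfolding blaschke_product_def by metis

subsection \<open>Dyadic levels of zeros\<close>

text \<open>For a point of the disc, level \<open>k\<close> means
  \<open>2^(-k-1) < 1 - |z| \<le> 2^(-k)\<close>. These annuli are half-open and partition the disc,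
  whereas the closed annuli of \<open>dyadic_zeros\<close> overlap on boundary circles.\<close>

definition disc_level :: "complex \<Rightarrow> nat" where
  "disc_level z = nat \<lfloor>- log 2 (1 - cmod z)\<rfloor>"

lemma disc_level:
  assumes "cmod z < 1"
  shows "1 / 2 ^ (disc_level z + 1) < 1 - cmod z" and "1 - cmod z \<le> 1 / 2 ^ disc_level z"
proof -
  define x where "x = - log 2 (1 - cmod z)"
  have x: "1 - cmod z = 2 powr (- x)" using assms by (simp add: x_def)
  have "x \<ge> 0"
    using assms by (simp add: x_def)
  then have l: "real (disc_level z) \<le> x" "x < real (disc_level z) + 1"
    by (auto simp: disc_level_def x_def[symmetric])
  have pw: "1 / 2 ^ k = 2 powr (- real k)" for k
    by (simp add: powr_minus powr_realpow inverse_eq_divide)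
  show "1 / 2 ^ (disc_level z + 1) < 1 - cmod z" "1 - cmod z \<le> 1 / 2 ^ disc_level z"
    unfolding pw x using l by auto
qed

lemma disc_level_eqI:
  assumes "1 / 2 ^ (k + 1) < 1 - cmod z" "1 - cmod z \<le> 1 / 2 ^ k"
  shows "disc_level z = k"
proof -
  have z: "cmod z < 1" using assms(1) by (smt (verit) zero_less_divide_1_iff zero_less_power)
  have less: "i < j + 1" if "1 / 2 ^ (j + 1) < (t::real)" "t \<le> 1 / 2 ^ i" for i j t
  proof -
    have "(1::real) / 2 ^ (j + 1) < 1 / 2 ^ i" using that by linarith
    then have "(2::real) ^ i < 2 ^ (j + 1)" by (simp add: field_simps)
    then show ?thesis by (simp only: power_strict_increasing_iff)
  qed
  show ?thesis
    using less[OF assms(1) disc_level(2)[OF z]] less[OF disc_level(1)[OF z] assms(2)] by simp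
qed

lemma sum_half_power_tail_le:
  assumes "finite A" "\<And>i. i \<in> A \<Longrightarrow> i > L"
  shows "(\<Sum>i\<in>A. (1/2::real) ^ i) \<le> (1/2) ^ L"
proof -
  obtain N where N: "A \<subseteq> {..N}" using assms(1) finite_nat_iff_bounded_le by blast
  have "(\<Sum>i\<in>A. (1/2::real) ^ i) \<le> (\<Sum>i\<in>{L<..max L N}. (1/2) ^ i)"
    using N assms(2) by (intro sum_mono2) auto
  also have "\<dots> = (1/2) ^ L - (1/2) ^ max L N"
  proof -
    have "(\<Sum>i\<in>{L<..L + m}. (1/2::real) ^ i) = (1/2) ^ L - (1/2) ^ (L + m)" for m
    proof (induction m)
      case (Suc m)
      have "{L<..L + Suc m} = insert (L + Suc m) {L<..L + m}" by auto
      then show ?case using Suc by simp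
    qed simp
    from this[of "max L N - L"] show ?thesis by simp
  qed
  also have "\<dots> \<le> (1/2) ^ L" by simp
  finally show ?thesis .
qed

text \<open>With truncated subtraction \<open>(j - k) + (k - j)\<close> is \<open>|j - k|\<close>.
  The indices above and below \<open>k\<close> each give one geometric tail, hence the factor
  \<open>2\<close>.\<close>

lemma sum_half_power_dist_le:
  fixes k L :: nat
  assumes "finite J"
  shows "(\<Sum>j | j \<in> J \<and> (j - k) + (k - j) > L. (1/2::real) ^ ((j - k) + (k - j))) \<le> 2 * (1/2) ^ L"
proof -
  let ?d = "\<lambda>j. (j - k) + (k - j)"
  define A B where "A = {j\<in>J. j > k + L}" and "B = {j\<in>J. k > j + L}"
  have AB: "{j \<in> J. ?d j > L} = A \<union> B" "A \<inter> B = {}" "finite A" "finite B"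
    using assms by (auto simp: A_def B_def)
  have "inj_on ?d A" unfolding A_def by (rule inj_onI, simp only: mem_Collect_eq, linarith)
  then have "(\<Sum>j\<in>A. (1/2::real) ^ ?d j) = (\<Sum>i\<in>?d ` A. (1/2) ^ i)"
    by (simp only: sum.reindex comp_def)
  also have "\<dots> \<le> (1/2) ^ L"
    using AB(3) by (intro sum_half_power_tail_le) (auto simp: A_def)
  finally have 1: "(\<Sum>j\<in>A. (1/2::real) ^ ?d j) \<le> (1/2) ^ L" .
  have "inj_on ?d B" unfolding B_def by (rule inj_onI, simp only: mem_Collect_eq, linarith)
  then have "(\<Sum>j\<in>B. (1/2::real) ^ ?d j) = (\<Sum>i\<in>?d ` B. (1/2) ^ i)"
    by (simp only: sum.reindex comp_def)
  also have "\<dots> \<le> (1/2) ^ L"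
    using AB(4) by (intro sum_half_power_tail_le) (auto simp: B_def)
  finally have 2: "(\<Sum>j\<in>B. (1/2::real) ^ ?d j) \<le> (1/2) ^ L" .
  show ?thesis
    unfolding AB(1) using 1 2 AB by (subst sum.union_disjoint) auto
qed

text \<open>The constant \<open>8\<close> is the \<open>4\<close> of the ratio bound times
  \<open>2\<close> for the width of one level.\<close>

lemma one_minus_norm_blaschke_factor_sq_le_level:
  assumes w: "cmod w < 1" and z: "cmod z < 1"
  defines "j \<equiv> disc_level w" and "k \<equiv> disc_level z"
  shows "1 - (cmod (blaschke_factor w z))\<^sup>2 \<le> 8 * (1/2) ^ ((j - k) + (k - j))"
proof (cases "k \<le> j")
  case True
  have "(1 - cmod w) / (1 - cmod z) \<le> (1 / 2 ^ j) / (1 / 2 ^ (k + 1))"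
    using disc_level[OF w] disc_level[OF z] w z
    by (intro frac_le) (auto simp: j_def k_def less_imp_le)
  also have "\<dots> = 2 * (1/2) ^ (j - k)"
    using True by (simp add: power_diff power_one_over field_simps)
  finally have "4 * ((1 - cmod w) / (1 - cmod z)) \<le> 8 * (1/2) ^ (j - k)"
    by linarith
  from order_trans[OF one_minus_norm_blaschke_factor_sq_le(1)[OF w z] this] show ?thesis
    using True by simp
next
  case False
  have "(1 - cmod z) / (1 - cmod w) \<le> (1 / 2 ^ k) / (1 / 2 ^ (j + 1))"
    using disc_level[OF w] disc_level[OF z] w z
    by (intro frac_le) (auto simp: j_def k_def less_imp_le)
  also have "\<dots> = 2 * (1/2) ^ (k - j)"
    using False by (simp add: power_diff power_one_over field_simps)
  finally have "4 * ((1 - cmod z) / (1 - cmod w)) \<le> 8 * (1/2) ^ (k - j)"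
    by linarith
  from order_trans[OF one_minus_norm_blaschke_factor_sq_le(2)[OF w z] this] show ?thesis
    using False by simp
qed

lemma sum_level_le:
  fixes c :: "nat \<Rightarrow> real"
  assumes "finite F" "\<And>k. card {n \<in> F. l n = k} \<le> M" "\<And>j. c j \<ge> 0"
  shows "(\<Sum>n\<in>F. c (l n)) \<le> real M * (\<Sum>j\<in>l ` F. c j)"
proof -
  have "(\<Sum>n\<in>F. c (l n)) = (\<Sum>j\<in>l ` F. \<Sum>n | n \<in> F \<and> l n = j. c (l n))"
    by (rule sum.image_gen[OF assms(1)])
  also have "\<dots> = (\<Sum>j\<in>l ` F. real (card {n \<in> F. l n = j}) * c j)"
    by (intro sum.cong refl) simp
  also have "\<dots> \<le> (\<Sum>j\<in>l ` F. real M * c j)"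
    using assms by (intro sum_mono mult_right_mono) auto
  finally show ?thesis by (simp add: sum_distrib_left)
qed

text \<open>Gives content to the bounds on \<open>card\<close> below, since an infinite set has
  cardinality \<open>0\<close>.\<close>

lemma finite_level:
  assumes w: "blaschke_sequence I w"
  shows "finite {n \<in> I. disc_level (w n) = k}"
proof -
  have "{n \<in> I. disc_level (w n) = k} \<subseteq> {n \<in> I. cmod (w n) \<le> 1 - 1 / 2 ^ (k + 1)}"
    using disc_level(1) blaschke_sequence_norm[OF w] by fastforce
  then show ?thesis
    using blaschke_sequence_finite_in_cball[OF w, of "1 - 1 / 2 ^ (k + 1)"]
    by (auto intro: finite_subset)
qed

text \<open>
  If \<open>\<bar>B z\<bar>\<close> is bounded away from \<open>1\<close> then \<open>z\<close> is near a zero of \<open>B\<close>: zeros on far away levels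
  contribute little to \<open>1 - \<bar>B z\<bar>\<^sup>2 \<le> (\<Sum>n. 1 - \<rho>\<^sub>n\<^sup>2)\<close>, and on the remaining levels there are
  boundedly many.
\<close>
lemma bprod_near_zero:
  assumes w: "blaschke_sequence I w" and M: "\<And>k. card {n \<in> I. disc_level (w n) = k} \<le> M"
    and \<delta>: "\<delta> > 0"
  obtains L \<rho> where "0 < \<rho>" "\<rho> < 1"
    "\<And>z. z \<in> ball 0 1 \<Longrightarrow> 1 - (cmod (bprod I w z))\<^sup>2 \<ge> \<delta> \<Longrightarrow>
       \<exists>n\<in>I. disc_level (w n) \<le> disc_level z + L \<and> disc_level z \<le> disc_level (w n) + L \<and>
             cmod (blaschke_factor (w n) z) \<le> \<rho>"
proof -
  \<comment> \<open>\<open>L\<close> is chosen so that zeros more than \<open>L\<close> levels away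
    contribute less than \<delta>\<open>/2\<close> in total; \<open>M + 1\<close> instead of
    \<open>M\<close> avoids a zero denominator.\<close>
  have "\<exists>L. (1/2) ^ L < \<delta> / (32 * (real M + 1))"
    using \<delta> by (intro real_arch_pow_inv) auto
  then obtain L where "(1/2) ^ L < \<delta> / (32 * (real M + 1))" ..
  then have L: "(real M + 1) * (16 * (1/2) ^ L) < \<delta> / 2"
    by (simp add: field_simps)
  \<comment> \<open>At most \<open>2 * L + 1\<close> near levels with \<open>M\<close> zeros each,
    every zero costing \<eta>, contribute at most \<delta>\<open>/2\<close>. The cap
    \<open>1/2\<close> keeps \<rho> positive.\<close>
  define \<eta> where "\<eta> = min (1/2) (\<delta> / (2 * (real M + 1) * (2 * real L + 1)))"
  have \<eta>: "0 < \<eta>" "\<eta> \<le> 1/2" using \<delta> unfolding \<eta>_def by (simp, intro min.cobounded1)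
  have "(real M + 1) * (real (2 * L + 1) * \<eta>) \<le>
        (real M + 1) * (real (2 * L + 1) * (\<delta> / (2 * (real M + 1) * (2 * real L + 1))))"
    by (intro mult_left_mono) (auto simp: \<eta>_def)
  also have "\<dots> = \<delta> / 2" by (simp add: divide_simps) (simp add: algebra_simps)
  finally have \<eta>_le: "(real M + 1) * (real (2 * L + 1) * \<eta>) \<le> \<delta> / 2" .
  define \<rho> where "\<rho> = sqrt (1 - \<eta>)"
  have \<rho>: "0 < \<rho>" "\<rho> < 1" using \<eta> by (auto simp: \<rho>_def)
  show ?thesis
  proof (rule that[OF \<rho>])
    fix z :: complex assume z: "z \<in> ball 0 1" and le: "1 - (cmod (bprod I w z))\<^sup>2 \<ge> \<delta>"
    let ?k = "disc_level z"
    let ?d = "\<lambda>j. (j - ?k) + (?k - j)"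
    \<comment> \<open>\<open>c j\<close> bounds the contribution of a zero on level \<open>j\<close>
      if no zero on a near level is within \<rho> of \<open>z\<close>.\<close>
    define c where "c = (\<lambda>j. if ?d j \<le> L then \<eta> else 8 * (1/2) ^ ?d j)"
    have c0: "c j \<ge> 0" for j using \<eta> by (simp add: c_def)
    show "\<exists>n\<in>I. disc_level (w n) \<le> ?k + L \<and> ?k \<le> disc_level (w n) + L \<and>
             cmod (blaschke_factor (w n) z) \<le> \<rho>"
    proof (rule ccontr)
      assume contra: "\<not> ?thesis"
      have n: "1 - (cmod (blaschke_factor (w n) z))\<^sup>2 \<le> c (disc_level (w n))" if n: "n \<in> I" for n
      proof (cases "?d (disc_level (w n)) \<le> L")
        case True
        then have "disc_level (w n) \<le> ?k + L" "?k \<le> disc_level (w n) + L" by linarith+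
        then have "cmod (blaschke_factor (w n) z) \<ge> \<rho>" using contra n by force
        then have "\<rho>\<^sup>2 \<le> (cmod (blaschke_factor (w n) z))\<^sup>2" using \<rho> by (intro power_mono) auto
        then show ?thesis using True \<eta> by (simp add: c_def \<rho>_def)
      next
        case False
        then show ?thesis
          using one_minus_norm_blaschke_factor_sq_le_level[OF blaschke_sequence_norm[OF w n], of z] z
          by (simp add: c_def)
      qed
      have "1 - (cmod (bprod I w z))\<^sup>2 \<le> (real M + 1) * (real (2 * L + 1) * \<eta> + 16 * (1/2) ^ L)"
      proof (rule one_minus_norm_bprod_sq_le[OF w z])
        fix F assume F: "finite F" "F \<subseteq> I"
        let ?l = "\<lambda>n. disc_level (w n)"
        let ?J = "?l ` F"
        have "(\<Sum>n\<in>F. 1 - (cmod (blaschke_factor (w n) z))\<^sup>2) \<le> (\<Sum>n\<in>F. c (?l n))"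
          using n F by (intro sum_mono) auto
        also have "\<dots> \<le> real M * (\<Sum>j\<in>?J. c j)"
        proof (rule sum_level_le[OF F(1) _ c0])
          fix k
          have "card {n \<in> F. ?l n = k} \<le> card {n \<in> I. disc_level (w n) = k}"
            using F finite_level[OF w] by (intro card_mono) auto
          then show "card {n \<in> F. ?l n = k} \<le> M" using M[of k] by linarith
        qed
        also have "(\<Sum>j\<in>?J. c j) = (\<Sum>j | j \<in> ?J \<and> ?d j \<le> L. c j) + (\<Sum>j | j \<in> ?J \<and> ?d j > L. c j)"
          using F by (subst sum.union_disjoint[symmetric]) (auto intro!: sum.cong)
        also have "\<dots> = (\<Sum>j | j \<in> ?J \<and> ?d j \<le> L. \<eta>) + 8 * (\<Sum>j | j \<in> ?J \<and> ?d j > L. (1/2) ^ ?d j)"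
          unfolding sum_distrib_left by (intro arg_cong2[where f = "(+)"] sum.cong) (auto simp: c_def)
        also have "\<dots> \<le> real (2 * L + 1) * \<eta> + 8 * (2 * (1/2) ^ L)"
        proof (intro add_mono mult_left_mono)
          have "{j. j \<in> ?J \<and> ?d j \<le> L} \<subseteq> {?k - L..?k + L}" by auto
          then have "card {j. j \<in> ?J \<and> ?d j \<le> L} \<le> card {?k - L..?k + L}"
            by (intro card_mono) auto
          also have "\<dots> \<le> 2 * L + 1" by simp
          finally have "real (card {j. j \<in> ?J \<and> ?d j \<le> L}) \<le> real (2 * L + 1)"
            by (rule of_nat_mono)
          then show "(\<Sum>j | j \<in> ?J \<and> ?d j \<le> L. \<eta>) \<le> real (2 * L + 1) * \<eta>"
            using \<eta> by (simp add: mult_right_mono)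
          show "(\<Sum>j | j \<in> ?J \<and> ?d j > L. (1/2::real) ^ ?d j) \<le> 2 * (1/2) ^ L"
            using F by (intro sum_half_power_dist_le) auto
        qed auto
        finally have "(\<Sum>n\<in>F. 1 - (cmod (blaschke_factor (w n) z))\<^sup>2) \<le>
            real M * (real (2 * L + 1) * \<eta> + 16 * (1/2) ^ L)"
          by (simp add: mult_left_mono)
        also have "\<dots> \<le> (real M + 1) * (real (2 * L + 1) * \<eta> + 16 * (1/2) ^ L)"
          using \<eta> by (intro mult_right_mono add_nonneg_nonneg) auto
        finally show "(\<Sum>n\<in>F. 1 - (cmod (blaschke_factor (w n) z))\<^sup>2) \<le>
            (real M + 1) * (real (2 * L + 1) * \<eta> + 16 * (1/2) ^ L)" .
      qed
      also have "\<dots> < \<delta>"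
        using L \<eta>_le unfolding distrib_left by linarith
      finally show False using le by simp
    qed
  qed
qed

subsection \<open>Splitting off the zeros of a bounded function\<close>

lemma norm_blaschke_factor_commute: "cmod (blaschke_factor w z) = cmod (blaschke_factor z w)"
proof -
  have "cmod (1 - cnj w * z) = cmod (cnj (1 - cnj w * z))" by (rule complex_mod_cnj[symmetric])
  then show ?thesis
    by (simp add: norm_blaschke_factor norm_minus_commute mult.commute)
qed

text \<open>\<open>card_eq\<close> lists the zeros with multiplicity. At a zero it also rules out an
  infinite fibre, whose cardinality would be \<open>0\<close>.\<close>

locale enumerated_zeros =
  fixes f :: "complex \<Rightarrow> complex" and I :: "nat set" and w :: "nat \<Rightarrow> complex" and \<beta> :: complex
  assumes f: "f holomorphic_on ball 0 1" and \<beta>: "\<beta> \<in> ball 0 1" "f \<beta> \<noteq> 0"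
    and f_le: "\<And>z. z \<in> ball 0 1 \<Longrightarrow> cmod (f z) \<le> 1"
    and w: "\<And>n. n \<in> I \<Longrightarrow> cmod (w n) < 1" "\<And>n. n \<in> I \<Longrightarrow> f (w n) = 0"
    and card_eq: "\<And>z. z \<in> ball 0 1 \<Longrightarrow> int (card {n \<in> I. w n = z}) = zorder f z"

lemma zero_enumeration:
  assumes f: "f holomorphic_on ball 0 1" and \<beta>: "\<beta> \<in> ball 0 1" "f \<beta> \<noteq> 0"
    and f_le: "\<And>z. z \<in> ball 0 1 \<Longrightarrow> cmod (f z) \<le> 1"
  obtains I w where "enumerated_zeros f I w \<beta>"
proof -
  define Z where "Z = {z \<in> ball 0 1. f z = 0}"
  \<comment> \<open>Each zero is replaced by as many tagged copies as its order; coding the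
    countable set \<open>S\<close> by natural numbers then gives an enumeration with
    multiplicity.\<close>
  define S where "S = Sigma Z (\<lambda>z. {..<nat (zorder f z)})"
  have "countable Z"
  proof -
    \<comment> \<open>The countability of the zeros is obtained for F-sigma sets, so the disc is
      exhausted by closed discs.\<close>
    have "(\<Union>n. cball 0 (1 - 1 / real (Suc n))) = ball (0::complex) 1"
    proof (intro equalityI subsetI)
      fix z :: complex assume "z \<in> ball 0 1"
      then have "0 < 1 - cmod z" by simp
      then obtain n where "inverse (real (Suc n)) < 1 - cmod z"
        using reals_Archimedean by blast
      then have "z \<in> cball 0 (1 - 1 / real (Suc n))" by (simp add: inverse_eq_divide)
      then show "z \<in> (\<Union>n. cball 0 (1 - 1 / real (Suc n)))" by blast
    next
      fix z :: complex assume "z \<in> (\<Union>n. cball 0 (1 - 1 / real (Suc n)))"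
      then obtain n where "cmod z \<le> 1 - 1 / real (Suc n)" by auto
      moreover have "0 < 1 / real (Suc n)" by simp
      ultimately show "z \<in> ball 0 1" unfolding mem_ball_0 by linarith
    qed
    then have fs: "fsigma (ball (0::complex) 1)"
      using fsigma.intros[of "\<lambda>n. cball (0::complex) (1 - 1 / real (Suc n))"] by simp
    show ?thesis
    proof (cases "Z = {}")
      case False
      then have "\<not> f constant_on ball 0 1"
        using \<beta> unfolding constant_on_def Z_def by (smt (verit) Collect_empty_eq)
      then show ?thesis
        using holomorphic_countable_zeros[OF f open_ball connected_ball fs] by (simp add: Z_def)
    qed simp
  qed
  then have S: "countable S" by (simp add: S_def)
  define I where "I = to_nat_on S ` S"
  define w where "w = (\<lambda>n. fst (from_nat_into S n))"
  have w: "w (to_nat_on S s) = fst s" if "s \<in> S" for s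
    using S that by (simp add: w_def)
  have "cmod (w n) < 1" "f (w n) = 0" if "n \<in> I" for n
    using that w by (auto simp: I_def S_def Z_def)
  moreover have "int (card {n \<in> I. w n = z}) = zorder f z" if z: "z \<in> ball 0 1" for z
  proof -
    have "{n \<in> I. w n = z} = to_nat_on S ` {s \<in> S. fst s = z}"
      using w by (auto simp: I_def)
    also have "card \<dots> = card {s \<in> S. fst s = z}"
      using inj_on_to_nat_on[OF S] by (intro card_image) (auto simp: inj_on_def)
    also have "{s \<in> S. fst s = z} = (if f z = 0 then {z} \<times> {..<nat (zorder f z)} else {})"
      using z by (auto simp: S_def Z_def)
    also have "card \<dots> = nat (zorder f z)"
      using zorder_nonneg_in_disc(2)[OF f \<beta> z] by (auto simp: card_cartesian_product)
    finally show ?thesis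
      using zorder_nonneg_in_disc(1)[OF f \<beta> z] by simp
  qed
  ultimately have "enumerated_zeros f I w \<beta>"
    using f \<beta> f_le by unfold_locales auto
  then show ?thesis by (rule that)
qed

context enumerated_zeros
begin

lemma finite_fibre:
  assumes z: "z \<in> ball 0 1"
  shows "finite {n \<in> I. w n = z}"
proof (cases "f z = 0")
  case True
  then have "card {n \<in> I. w n = z} \<noteq> 0"
    using zorder_nonneg_in_disc(2)[OF f \<beta> z] card_eq[OF z] by simp
  then show ?thesis by (rule contrapos_np) (rule card.infinite)
next
  case False
  then have *: "{n \<in> I. w n = z} = {}" using w(2) by auto
  show ?thesis unfolding * by simp
qed

lemma norm_le_prod:
  assumes "finite F" "F \<subseteq> I" "z \<in> ball 0 1"
  shows "cmod (f z) \<le> (\<Prod>n\<in>F. cmod (blaschke_factor (w n) z))"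
proof (rule norm_le_prod_blaschke_factor[OF assms(1) f f_le \<beta> _ _ assms(3)])
  fix z :: complex assume z: "z \<in> ball 0 1"
  have "card {n \<in> F. w n = z} \<le> card {n \<in> I. w n = z}"
    using assms finite_fibre[OF z] by (intro card_mono) auto
  then show "int (card {n \<in> F. w n = z}) \<le> zorder f z"
    using card_eq[OF z] by simp
qed (use assms w in auto)

text \<open>Each zero within \<rho> of \<open>p\<close> puts a factor at most \<rho> into the upper
  bound for \<open>|f p|\<close>, so a lower bound for \<open>|f p|\<close> limits their number,
  uniformly in \<open>p\<close>.\<close>

lemma zeros_near_bounded:
  assumes "0 < \<rho>" "\<rho> < 1" "0 < \<alpha>"
  obtains m where "\<And>p. p \<in> ball 0 1 \<Longrightarrow> cmod (f p) \<ge> \<alpha> \<Longrightarrow>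
    finite {n \<in> I. cmod (blaschke_factor (w n) p) \<le> \<rho>} \<and>
    card {n \<in> I. cmod (blaschke_factor (w n) p) \<le> \<rho>} \<le> m"
proof -
  obtain m where m: "\<rho> ^ m < \<alpha>" using real_arch_pow_inv[OF assms(3,2)] by blast
  show ?thesis
  proof (rule that[of m], rule finite_if_finite_subsets_card_bdd)
    fix p G assume p: "p \<in> ball 0 1" "cmod (f p) \<ge> \<alpha>"
      and G: "G \<subseteq> {n \<in> I. cmod (blaschke_factor (w n) p) \<le> \<rho>}" "finite G"
    have "\<alpha> \<le> (\<Prod>n\<in>G. cmod (blaschke_factor (w n) p))"
    proof -
      have "G \<subseteq> I" using G by auto
      then show ?thesis using norm_le_prod[OF G(2) _ p(1)] p(2) by linarith
    qed
    also have "\<dots> \<le> (\<Prod>n\<in>G. \<rho>)"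
      using G by (intro prod_mono) auto
    finally have "\<rho> ^ m < \<rho> ^ card G" using m by simp
    then show "card G \<le> m"
      using assms power_strict_decreasing_iff[of \<rho> m "card G"] by simp
  qed
qed

text \<open>Take logarithms in the finite product bound at \<beta>. With \<open>x\<close> the
  squared modulus of a factor, \<open>- ln x \<ge> 1 - x\<close>, and \<open>1 - x\<close> dominates
  a fixed multiple of \<open>1 - |w n|\<close>.\<close>

lemma blaschke_sequence: "blaschke_sequence I w"
  unfolding blaschke_sequence_def
proof (intro conjI ballI)
  show "w n \<in> ball 0 1" if "n \<in> I" for n using w that by simp
  define C where "C = (4 / (1 - cmod \<beta>)) * (- ln ((cmod (f \<beta>))\<^sup>2))"
  have "(\<Sum>n\<in>F. 1 - cmod (w n)) \<le> C" if F: "F \<subseteq> I" "finite F" for F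
  proof -
    define r where "r = (\<lambda>n. (cmod (blaschke_factor (w n) \<beta>))\<^sup>2)"
    have le: "cmod (f \<beta>) \<le> (\<Prod>n\<in>F. cmod (blaschke_factor (w n) \<beta>))"
      by (rule norm_le_prod[OF F(2,1) \<beta>(1)])
    then have "(\<Prod>n\<in>F. cmod (blaschke_factor (w n) \<beta>)) \<noteq> 0"
      using \<beta>(2) by auto
    then have r_pos: "r n > 0" if "n \<in> F" for n
      using that F by (auto simp: r_def)
    have "(cmod (f \<beta>))\<^sup>2 \<le> (\<Prod>n\<in>F. r n)"
      using le by (auto simp: r_def prod_power_distrib[symmetric] intro: power_mono)
    then have "ln ((cmod (f \<beta>))\<^sup>2) \<le> ln (\<Prod>n\<in>F. r n)"
      using \<beta>(2) r_pos by (subst ln_le_cancel_iff) (auto intro: prod_pos)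
    also have "\<dots> = (\<Sum>n\<in>F. ln (r n))"
      using r_pos F by (intro ln_prod) (simp_all add: less_imp_neq[symmetric])
    finally have ln: "(\<Sum>n\<in>F. - ln (r n)) \<le> - ln ((cmod (f \<beta>))\<^sup>2)"
      by (simp add: sum_negf)
    have "(1 - cmod \<beta>) / 4 * (\<Sum>n\<in>F. 1 - cmod (w n)) = (\<Sum>n\<in>F. (1 - cmod \<beta>) * (1 - cmod (w n)) / 4)"
      by (simp add: sum_distrib_left)
    also have "\<dots> \<le> (\<Sum>n\<in>F. - ln (r n))"
    proof (rule sum_mono)
      fix n assume n: "n \<in> F"
      have "(1 - cmod \<beta>) * (1 - cmod (w n)) / 4 \<le> 1 - r n"
        using one_minus_norm_blaschke_factor_sq_ge[of "w n" \<beta>] w n F \<beta> by (auto simp: r_def)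
      also have "\<dots> \<le> - ln (r n)"
        using ln_le_minus_one[OF r_pos[OF n]] by simp
      finally show "(1 - cmod \<beta>) * (1 - cmod (w n)) / 4 \<le> - ln (r n)" .
    qed
    also note ln
    finally show ?thesis
      using \<beta>(1) by (simp add: C_def field_simps)
  qed
  then show "(\<lambda>n. 1 - cmod (w n)) summable_on I"
    using w by (intro nonneg_bdd_above_summable_on bdd_aboveI[of _ C]) (auto simp: less_imp_le)
qed

text \<open>The finite product bounds pass to the limit, so \<open>f\<close> can be divided by its
  Blaschke product. Both have the same order at every point, hence the quotient has order
  \<open>0\<close>.\<close>

lemma zero_free_factor:
  obtains g where "g holomorphic_on ball 0 1" "\<And>z. z \<in> ball 0 1 \<Longrightarrow> f z = bprod I w z * g z"
    "\<And>z. z \<in> ball 0 1 \<Longrightarrow> cmod (g z) \<le> 1" "\<And>z. z \<in> ball 0 1 \<Longrightarrow> g z \<noteq> 0"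
proof -
  have le: "cmod (f z) \<le> cmod (bprod I w z)" if z: "z \<in> ball 0 1" for z
  proof (rule LIMSEQ_le_const[OF bprod_tendsto_norm[OF blaschke_sequence z]])
    show "\<exists>N. \<forall>n\<ge>N. cmod (f z) \<le> (\<Prod>n\<in>I \<inter> {..n}. cmod (blaschke_factor (w n) z))"
      using norm_le_prod z by auto
  qed
  have hol: "bprod I w holomorphic_on ball 0 1" by (rule bprod_holomorphic[OF blaschke_sequence])
  have nz: "bprod I w \<beta> \<noteq> 0" using le[OF \<beta>(1)] \<beta>(2) by auto
  obtain g where g: "g holomorphic_on ball 0 1" "\<And>z. z \<in> ball 0 1 \<Longrightarrow> f z = bprod I w z * g z"
    "\<And>z. z \<in> ball 0 1 \<Longrightarrow> cmod (g z) \<le> 1"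
    using holomorphic_division[OF f hol \<beta>(1) nz le] by metis
  have g\<beta>: "g \<beta> \<noteq> 0" using g(2)[OF \<beta>(1)] \<beta>(2) by auto
  have "g z \<noteq> 0" if z: "z \<in> ball 0 1" for z
  proof -
    have "zorder f z = zorder (\<lambda>z. bprod I w z * g z) z"
      using g(2) z by (intro zorder_cong_in_disc)
    also have "\<dots> = zorder (bprod I w) z + zorder g z"
      using nz g\<beta> by (intro zorder_mult_in_disc[OF hol g(1) \<beta>(1) _ z]) auto
    finally have "zorder g z = 0"
      using zorder_bprod[OF blaschke_sequence z] card_eq[OF z] by simp
    then show ?thesis
      using zorder_nonneg_in_disc(2)[OF g(1) \<beta>(1) g\<beta> z] by simp
  qed
  with g that show ?thesis by blast
qed

end

section \<open>Level counts and the exponential condition\<close>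

lemma level_window_bound:
  assumes w: "blaschke_sequence I w" and M: "\<And>k. card {n \<in> I. disc_level (w n) = k} \<le> M"
  shows "finite {n \<in> I. disc_level (w n) \<le> k + L \<and> k \<le> disc_level (w n) + L}"
    and "card {n \<in> I. disc_level (w n) \<le> k + L \<and> k \<le> disc_level (w n) + L} \<le> (2 * L + 1) * M"
proof -
  have eq: "{n \<in> I. disc_level (w n) \<le> k + L \<and> k \<le> disc_level (w n) + L} =
        (\<Union>j\<in>{k - L..k + L}. {n \<in> I. disc_level (w n) = j})"
    by auto
  show "finite {n \<in> I. disc_level (w n) \<le> k + L \<and> k \<le> disc_level (w n) + L}"
    unfolding eq using finite_level[OF w] by blast
  have "card (\<Union>j\<in>{k - L..k + L}. {n \<in> I. disc_level (w n) = j}) \<le>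
        (\<Sum>j\<in>{k - L..k + L}. card {n \<in> I. disc_level (w n) = j})"
    by (rule card_UN_le) simp
  also have "\<dots> \<le> (\<Sum>j\<in>{k - L..k + L}. M)"
    by (intro sum_mono M)
  also have "\<dots> = card {k - L..k + L} * M"
    by simp
  also have "\<dots> \<le> (2 * L + 1) * M"
    by (intro mult_right_mono) auto
  finally show "card {n \<in> I. disc_level (w n) \<le> k + L \<and> k \<le> disc_level (w n) + L} \<le> (2 * L + 1) * M"
    unfolding eq .
qed

text \<open>The circle \<open>1 - |z| = 2^(-k-1)\<close> lies in the closed annulus \<open>k\<close>
  but on level \<open>k + 1\<close>.\<close>

lemma dyadic_zeros_level:
  assumes "z \<in> dyadic_zeros B k"
  shows "disc_level z = k \<or> disc_level z = k + 1"
proof (cases "1 / 2 ^ (k + 1) = 1 - cmod z")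
  case True
  then have "disc_level z = k + 1"
    by (intro disc_level_eqI) (auto simp flip: True simp: field_simps)
  then show ?thesis ..
next
  case False
  then show ?thesis
    using assms by (auto intro!: disc_level_eqI simp: dyadic_zeros_def)
qed

lemma exponential_imp_level_bound:
  assumes B: "exponential_blaschke_product B"
    and w: "blaschke_sequence I w" and eq: "\<And>z. z \<in> ball 0 1 \<Longrightarrow> B z = bprod I w z"
  obtains M where "\<And>k. card {n \<in> I. disc_level (w n) = k} \<le> M"
proof -
  obtain M0 :: real where M0: "\<And>k. k \<ge> 1 \<Longrightarrow> finite (dyadic_zeros B k)"
    "\<And>k. k \<ge> 1 \<Longrightarrow> real_of_int (\<Sum>z\<in>dyadic_zeros B k. zorder B z) \<le> M0"
    using B unfolding exponential_blaschke_product_def by auto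
  \<comment> \<open>The exponential condition starts at \<open>k = 1\<close>, so level
    \<open>0\<close> enters with its own finite count.\<close>
  define M where "M = max (nat \<lceil>M0\<rceil>) (card {n \<in> I. disc_level (w n) = 0})"
  have "card {n \<in> I. disc_level (w n) = k} \<le> M" for k
  proof (cases "k = 0")
    case False
    then have k: "k \<ge> 1" by simp
    have fin: "finite {n \<in> I. w n = z}" for z
      using finite_level[OF w, of "disc_level z"] by (auto elim: rev_finite_subset)
    have "{n \<in> I. disc_level (w n) = k} \<subseteq> (\<Union>z\<in>dyadic_zeros B k. {n \<in> I. w n = z})"
    proof
      fix n assume n: "n \<in> {n \<in> I. disc_level (w n) = k}"
      then have wn: "cmod (w n) < 1" using blaschke_sequence_norm[OF w] by auto
      have "B (w n) = 0" using eq[of "w n"] wn n bprod_eq_0_iff[OF w, of "w n"] by auto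
      then have "w n \<in> dyadic_zeros B k"
        using n wn disc_level[OF wn] by (auto simp: dyadic_zeros_def)
      then show "n \<in> (\<Union>z\<in>dyadic_zeros B k. {n \<in> I. w n = z})" using n by auto
    qed
    then have "card {n \<in> I. disc_level (w n) = k} \<le> card (\<Union>z\<in>dyadic_zeros B k. {n \<in> I. w n = z})"
      using M0(1)[OF k] fin by (intro card_mono) auto
    also have "\<dots> \<le> (\<Sum>z\<in>dyadic_zeros B k. card {n \<in> I. w n = z})"
      by (rule card_UN_le[OF M0(1)[OF k]])
    finally have "int (card {n \<in> I. disc_level (w n) = k}) \<le> (\<Sum>z\<in>dyadic_zeros B k. int (card {n \<in> I. w n = z}))"
      by (simp flip: of_nat_sum)
    also have "\<dots> = (\<Sum>z\<in>dyadic_zeros B k. zorder B z)"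
    proof (rule sum.cong)
      fix z assume "z \<in> dyadic_zeros B k"
      then have z: "z \<in> ball 0 1" by (simp add: dyadic_zeros_def)
      show "int (card {n \<in> I. w n = z}) = zorder B z"
        using zorder_bprod[OF w z] zorder_cong_in_disc[of B "bprod I w", OF eq z] by simp
    qed auto
    finally have "real (card {n \<in> I. disc_level (w n) = k}) \<le> M0"
      using M0(2)[OF k] by linarith
    then show ?thesis unfolding M_def by linarith
  qed (simp add: M_def)
  then show ?thesis by (rule that)
qed

lemma level_bound_imp_exponential:
  assumes w: "blaschke_sequence I w" and M: "\<And>k. card {n \<in> I. disc_level (w n) = k} \<le> M"
  shows "exponential_blaschke_product (bprod I w)"
  unfolding exponential_blaschke_product_def
proof (intro conjI exI allI impI)
  show "blaschke_product (bprod I w)" by (rule blaschke_product_bprod[OF w])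
  \<comment> \<open>Each closed annulus meets two levels, hence \<open>2 * M\<close>; the
    \<open>1\<close> keeps the constant positive when \<open>M = 0\<close>.\<close>
  show "0 < 2 * real M + 1" by simp
  fix k :: nat
  let ?D = "dyadic_zeros (bprod I w) k"
  let ?S = "{n \<in> I. disc_level (w n) = k} \<union> {n \<in> I. disc_level (w n) = k + 1}"
  have S: "finite ?S" using finite_level[OF w] by simp
  have zero: "\<exists>n\<in>I. w n = z" if "z \<in> ?D" for z
    using that bprod_eq_0_iff[OF w, of z] by (auto simp: dyadic_zeros_def)
  have "?D \<subseteq> w ` ?S"
    using zero dyadic_zeros_level by fastforce
  then show D: "finite ?D" using S by (meson finite_imageI finite_subset)
  have fin: "finite {n \<in> I. w n = z}" for z
    using finite_level[OF w, of "disc_level z"] by (auto elim: rev_finite_subset)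
  have "(\<Sum>z\<in>?D. zorder (bprod I w) z) = (\<Sum>z\<in>?D. int (card {n \<in> I. w n = z}))"
    by (intro sum.cong refl zorder_bprod[OF w]) (simp add: dyadic_zeros_def)
  also have "\<dots> = int (\<Sum>z\<in>?D. card {n \<in> I. w n = z})" by simp
  also have "(\<Sum>z\<in>?D. card {n \<in> I. w n = z}) = card (\<Union>z\<in>?D. {n \<in> I. w n = z})"
    using D fin by (intro card_UN_disjoint[symmetric]) auto
  also have "\<dots> \<le> card ?S"
    using dyadic_zeros_level by (intro card_mono S) blast
  also have "\<dots> \<le> card {n \<in> I. disc_level (w n) = k} + card {n \<in> I. disc_level (w n) = k + 1}"
    by (rule card_Un_le)
  also have "\<dots> \<le> 2 * M" using M[of k] M[of "k + 1"] by simp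
  finally have "(\<Sum>z\<in>?D. zorder (bprod I w) z) \<le> int (2 * M)" by simp
  then show "real_of_int (\<Sum>z\<in>?D. zorder (bprod I w) z) \<le> 2 * real M + 1" by linarith
qed

section \<open>Estimates for the Frostman transform \<open>(u - a) / (1 - cnj a * u)\<close>\<close>

lemma frostman_denominator_nonzero:
  assumes "cmod a < 1" "cmod u \<le> 1"
  shows "1 - cnj a * u \<noteq> 0" "1 - cmod a \<le> cmod (1 - cnj a * u)" "cmod (1 - cnj a * u) \<le> 2"
proof -
  have le: "cmod (cnj a * u) \<le> cmod a" using assms by (simp add: norm_mult mult_left_le)
  then show 1: "1 - cmod a \<le> cmod (1 - cnj a * u)"
    using norm_triangle_ineq2[of 1 "cnj a * u"] by simp
  then show "1 - cnj a * u \<noteq> 0" using assms by auto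
  show "cmod (1 - cnj a * u) \<le> 2" using norm_triangle_ineq4[of 1 "cnj a * u"] le assms by simp
qed

lemma one_minus_norm_frostman_sq:
  assumes "cmod a < 1" "cmod u \<le> 1"
  shows "(1 - (cmod ((u - a) / (1 - cnj a * u)))\<^sup>2) * (cmod (1 - cnj a * u))\<^sup>2 =
         (1 - (cmod a)\<^sup>2) * (1 - (cmod u)\<^sup>2)"
proof -
  have "(cmod (1 - cnj a * u))\<^sup>2 - (cmod (u - a))\<^sup>2 = (1 - (cmod a)\<^sup>2) * (1 - (cmod u)\<^sup>2)"
    unfolding cmod_power2 by (simp add: algebra_simps power2_eq_square)
  moreover have "cmod (1 - cnj a * u) \<noteq> 0"
    using frostman_denominator_nonzero(1)[OF assms] by simp
  ultimately show ?thesis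
    by (simp add: norm_divide power_divide left_diff_distrib)
qed

lemma norm_frostman_le_1:
  assumes "cmod a < 1" "cmod u \<le> 1"
  shows "cmod ((u - a) / (1 - cnj a * u)) \<le> 1"
proof -
  have "0 \<le> (1 - (cmod a)\<^sup>2) * (1 - (cmod u)\<^sup>2)"
    using assms by (intro mult_nonneg_nonneg) (auto simp: abs_square_le_1)
  then have "0 \<le> 1 - (cmod ((u - a) / (1 - cnj a * u)))\<^sup>2"
    using frostman_denominator_nonzero(1)[OF assms] one_minus_norm_frostman_sq[OF assms]
    by (metis norm_eq_zero zero_le_mult_iff zero_less_norm_iff zero_less_power not_le)
  then show ?thesis
    using abs_square_le_1 by force
qed

text \<open>If the transformed value stays away from the circle, so does \<open>u\<close>. This
  makes \<open>bprod_near_zero\<close> applicable where the shifted function is small.\<close>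

lemma one_minus_norm_sq_ge_frostman:
  assumes a: "cmod a < 1" and u: "cmod u \<le> 1"
  shows "(1 - (cmod ((u - a) / (1 - cnj a * u)))\<^sup>2) * (1 - cmod a)\<^sup>2 \<le> 1 - (cmod u)\<^sup>2"
proof -
  have "(1 - (cmod ((u - a) / (1 - cnj a * u)))\<^sup>2) * (1 - cmod a)\<^sup>2 \<le>
        (1 - (cmod ((u - a) / (1 - cnj a * u)))\<^sup>2) * (cmod (1 - cnj a * u))\<^sup>2"
    using norm_frostman_le_1[OF a u] frostman_denominator_nonzero(2)[OF a u] a
    by (intro mult_left_mono power_mono) (auto simp: abs_square_le_1)
  also have "\<dots> \<le> 1 - (cmod u)\<^sup>2"
    unfolding one_minus_norm_frostman_sq[OF a u]
    using a u by (intro mult_left_le_one_le) (auto simp: abs_square_le_1)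
  finally show ?thesis .
qed

text \<open>\<open>(1 + |a|) / 2\<close> is the midpoint of \<open>|a|\<close> and \<open>1\<close>,
  so \<open>u\<close> keeps half the gap as distance from \<open>a\<close>, and the denominator is
  at most \<open>2\<close>.\<close>

lemma norm_frostman_ge:
  assumes a: "cmod a < 1" and u: "cmod u \<le> 1" and ge: "(1 + cmod a) / 2 \<le> cmod u"
  shows "(1 - cmod a) / 4 \<le> cmod ((u - a) / (1 - cnj a * u))"
proof -
  have "(1 - cmod a) / 2 \<le> cmod (u - a)"
    using norm_triangle_ineq2[of u a] ge by simp
  then have "(1 - cmod a) / 2 / 2 \<le> cmod (u - a) / cmod (1 - cnj a * u)"
    using frostman_denominator_nonzero[OF a u] a by (intro frac_le) auto
  then show ?thesis by (simp add: norm_divide)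
qed

text \<open>Converts pseudohyperbolic into Euclidean closeness, at the scale of the distance of
  \<open>z\<close> from the circle.\<close>

lemma dist_le_of_norm_blaschke_factor_le:
  assumes "cmod p < 1" "cmod z < 1" "cmod (blaschke_factor p z) \<le> \<rho>" "0 \<le> \<rho>" "\<rho> < 1"
  shows "cmod (z - p) \<le> 2 * (1 - cmod z) / (1 - \<rho>)"
proof -
  \<comment> \<open>This bounds the denominator by \<open>2 * (1 - |z|) + |z - p|\<close>; the
    second term is absorbed into the left-hand side because \<rho>\<open>< 1\<close>.\<close>
  have "1 - cnj p * z = of_real 1 - z * cnj z + cnj (z - p) * z"
    by (simp add: algebra_simps)
  then have "1 - cnj p * z = of_real (1 - (cmod z)\<^sup>2) + cnj (z - p) * z"
    by (simp only: of_real_diff complex_norm_square)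
  then have "cmod (1 - cnj p * z) \<le> cmod (of_real (1 - (cmod z)\<^sup>2)) + cmod (cnj (z - p) * z)"
    by (metis norm_triangle_ineq)
  also have "cmod (of_real (1 - (cmod z)\<^sup>2)) = 1 - (cmod z)\<^sup>2"
    using assms(2) by (simp only: norm_of_real) (simp add: abs_square_le_1)
  also have "1 - (cmod z)\<^sup>2 \<le> 2 * (1 - cmod z)"
    using zero_le_power2[of "1 - cmod z"] by (simp add: power2_eq_square algebra_simps)
  also have "cmod (cnj (z - p) * z) \<le> cmod (z - p)"
    using assms(2) by (simp add: norm_mult mult_left_le del: complex_cnj_diff)
  finally have 1: "cmod (1 - cnj p * z) \<le> 2 * (1 - cmod z) + cmod (z - p)" by simp
  have "cmod (z - p) \<le> \<rho> * cmod (1 - cnj p * z)"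
    using assms(3) one_minus_cnj_mult_nonzero[OF assms(1,2)]
    by (simp add: norm_blaschke_factor norm_minus_commute divide_le_eq)
  also have "\<dots> \<le> \<rho> * (2 * (1 - cmod z) + cmod (z - p))"
    using 1 assms by (intro mult_left_mono)
  also have "\<dots> \<le> 2 * (1 - cmod z) + \<rho> * cmod (z - p)"
    using assms by (simp add: distrib_left mult_left_le_one_le)
  finally have "cmod (z - p) * (1 - \<rho>) \<le> 2 * (1 - cmod z)" by (simp add: algebra_simps)
  then show ?thesis using assms by (simp add: field_simps)
qed

subsection \<open>Frostman shifts of exponential Blaschke products\<close>

text \<open>The case \<open>a = 0\<close>, where the shift is the product itself, is excluded:
  \<open>|a| > 0\<close> keeps the shifted function nonzero at the zeros of the product.\<close>

locale frostman_shift =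
  fixes J :: "nat set" and v :: "nat \<Rightarrow> complex" and M :: nat and a :: complex
  assumes v: "blaschke_sequence J v" and M: "\<And>k. card {n \<in> J. disc_level (v n) = k} \<le> M"
    and a: "0 < cmod a" "cmod a < 1"
begin

abbreviation "B \<equiv> bprod J v"

definition b :: "complex \<Rightarrow> complex" where "b z = (B z - a) / (1 - cnj a * B z)"

lemma B_le: "z \<in> ball 0 1 \<Longrightarrow> cmod (B z) \<le> 1"
  by (rule norm_bprod_le_1[OF v])

lemma b_holomorphic: "b holomorphic_on ball 0 1"
  unfolding b_def[abs_def]
  using frostman_denominator_nonzero(1)[OF a(2) B_le]
  by (intro holomorphic_intros bprod_holomorphic[OF v]) auto

lemma b_le: "z \<in> ball 0 1 \<Longrightarrow> cmod (b z) \<le> 1"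
  unfolding b_def by (rule norm_frostman_le_1[OF a(2) B_le])

lemma v_in_disc: "i \<in> J \<Longrightarrow> v i \<in> ball 0 1"
  using blaschke_sequence_norm[OF v] by simp

text \<open>Here \<open>b\<close> takes the value \<open>-a\<close>. The zeros of \<open>B\<close>
  serve as reference points where \<open>|b|\<close> is known.\<close>

lemma norm_b_at_zero: "i \<in> J \<Longrightarrow> cmod (b (v i)) = cmod a"
  using bprod_eq_0_iff[OF v v_in_disc, of i] by (auto simp: b_def)

lemma zero_of_b: "z \<in> ball 0 1 \<Longrightarrow> b z = 0 \<Longrightarrow> B z = a"
  using frostman_denominator_nonzero(1)[OF a(2) B_le] by (auto simp: b_def)

lemma one_minus_norm_a_sq: "1 - (cmod a)\<^sup>2 > 0"
  using a by (simp add: abs_square_less_1)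

text \<open>If \<open>b 0 = 0\<close> then \<open>|B 0| = |a| < 1\<close>, which forces
  \<open>B\<close> to have a zero, and \<open>b\<close> does not vanish there.\<close>

lemma b_not_identically_0:
  obtains \<beta> where "\<beta> \<in> ball 0 1" "b \<beta> \<noteq> 0"
proof (cases "b 0 = 0")
  case True
  then have "B 0 = a" using zero_of_b[of 0] by simp
  then have "1 - (cmod (B 0))\<^sup>2 \<ge> 1 - (cmod a)\<^sup>2" by simp
  then obtain i where "i \<in> J"
    using bprod_near_zero[OF v M one_minus_norm_a_sq] by (metis centre_in_ball zero_less_one)
  then show ?thesis using norm_b_at_zero[of i] v_in_disc[of i] a that[of "v i"] by force
qed (use that[of 0] in auto)

text \<open>At a zero of \<open>b\<close> one has \<open>|B| = |a|\<close>, so some zero of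
  \<open>B\<close> within \<open>L\<close> levels is near it. There are at most
  \<open>(2 * L + 1) * M\<close> such zeros of \<open>B\<close>, and each has at most
  \<open>m\<close> zeros of \<open>b\<close> near it.\<close>

lemma level_bound:
  assumes "enumerated_zeros b I w \<beta>"
  obtains C where "\<And>k. card {n \<in> I. disc_level (w n) = k} \<le> C"
proof -
  interpret enumerated_zeros b I w \<beta> by fact
  obtain L \<rho> where \<rho>: "0 < \<rho>" "\<rho> < 1" and near:
    "\<And>z. z \<in> ball 0 1 \<Longrightarrow> 1 - (cmod (B z))\<^sup>2 \<ge> 1 - (cmod a)\<^sup>2 \<Longrightarrow>
       \<exists>n\<in>J. disc_level (v n) \<le> disc_level z + L \<and> disc_level z \<le> disc_level (v n) + L \<and>
             cmod (blaschke_factor (v n) z) \<le> \<rho>"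
    by (rule bprod_near_zero[OF v M one_minus_norm_a_sq]) (rule that; blast)
  obtain m where m: "\<And>p. p \<in> ball 0 1 \<Longrightarrow> cmod (b p) \<ge> cmod a \<Longrightarrow>
    finite {n \<in> I. cmod (blaschke_factor (w n) p) \<le> \<rho>} \<and>
    card {n \<in> I. cmod (blaschke_factor (w n) p) \<le> \<rho>} \<le> m"
    by (rule zeros_near_bounded[OF \<rho> a(1)]) (rule that; blast)
  have m': "finite {n \<in> I. cmod (blaschke_factor (w n) (v i)) \<le> \<rho>}"
    "card {n \<in> I. cmod (blaschke_factor (w n) (v i)) \<le> \<rho>} \<le> m" if "i \<in> J" for i
    using m[OF v_in_disc[OF that]] norm_b_at_zero[OF that] by auto
  have "card {n \<in> I. disc_level (w n) = k} \<le> ((2 * L + 1) * M) * m" for k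
  proof -
    define Q where "Q = {i \<in> J. disc_level (v i) \<le> k + L \<and> k \<le> disc_level (v i) + L}"
    have Q: "finite Q" "card Q \<le> (2 * L + 1) * M" "Q \<subseteq> J"
      using level_window_bound[OF v M] by (auto simp: Q_def)
    have "{n \<in> I. disc_level (w n) = k} \<subseteq>
        (\<Union>i\<in>Q. {n \<in> I. cmod (blaschke_factor (w n) (v i)) \<le> \<rho>})"
    proof
      fix n assume n: "n \<in> {n \<in> I. disc_level (w n) = k}"
      then have "w n \<in> ball 0 1" "B (w n) = a" using zero_of_b[of "w n"] w by auto
      with near[of "w n"] obtain i where "i \<in> J" "disc_level (v i) \<le> k + L"
        "k \<le> disc_level (v i) + L" "cmod (blaschke_factor (w n) (v i)) \<le> \<rho>"
        using n by (auto simp: norm_blaschke_factor_commute)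
      then show "n \<in> (\<Union>i\<in>Q. {n \<in> I. cmod (blaschke_factor (w n) (v i)) \<le> \<rho>})"
        using n by (auto simp: Q_def)
    qed
    then have "card {n \<in> I. disc_level (w n) = k} \<le>
        card (\<Union>i\<in>Q. {n \<in> I. cmod (blaschke_factor (w n) (v i)) \<le> \<rho>})"
      using Q m' by (intro card_mono) auto
    also have "\<dots> \<le> (\<Sum>i\<in>Q. card {n \<in> I. cmod (blaschke_factor (w n) (v i)) \<le> \<rho>})"
      by (rule card_UN_le[OF Q(1)])
    also have "\<dots> \<le> (\<Sum>i\<in>Q. m)"
      using Q m' by (intro sum_mono) auto
    also have "\<dots> \<le> ((2 * L + 1) * M) * m"
      using Q by simp
    finally show ?thesis .
  qed
  then show ?thesis by (rule that)
qed

text \<open>Near a zero of \<open>B\<close>, Harnack's inequality starts from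
  \<open>|g| \<ge> |b| = |a|\<close> at that zero. Elsewhere \<open>|B|\<close> is at least
  \<open>(1 + |a|) / 2\<close>, and \<open>|b|\<close> itself is bounded below.\<close>

lemma zero_free_majorant_bounded_below:
  assumes g: "g holomorphic_on ball 0 1" "\<And>z. z \<in> ball 0 1 \<Longrightarrow> cmod (g z) \<le> 1"
    "\<And>z. z \<in> ball 0 1 \<Longrightarrow> g z \<noteq> 0" "\<And>z. z \<in> ball 0 1 \<Longrightarrow> cmod (b z) \<le> cmod (g z)"
  obtains \<kappa> where "0 < \<kappa>" "\<And>z. z \<in> ball 0 1 \<Longrightarrow> \<kappa> \<le> cmod (g z)"
proof -
  define \<delta> where "\<delta> = 1 - ((1 + cmod a) / 2)\<^sup>2"
  have "\<delta> > 0" using a by (simp add: \<delta>_def abs_square_less_1 del: power_divide)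
  then obtain L \<rho> where \<rho>: "0 < \<rho>" "\<rho> < 1" and near:
    "\<And>z. z \<in> ball 0 1 \<Longrightarrow> 1 - (cmod (B z))\<^sup>2 \<ge> \<delta> \<Longrightarrow>
       \<exists>n\<in>J. disc_level (v n) \<le> disc_level z + L \<and> disc_level z \<le> disc_level (v n) + L \<and>
             cmod (blaschke_factor (v n) z) \<le> \<rho>"
    by (rule bprod_near_zero[OF v M]) (rule that; blast)
  define K where "K = 4 * (1 - ln (cmod a)) / (1 - \<rho>\<^sup>2)"
  define \<kappa> where "\<kappa> = min (exp (- K)) ((1 - cmod a) / 4)"
  show ?thesis
  proof (rule that[of \<kappa>])
    show "\<kappa> > 0" using a by (simp add: \<kappa>_def)
    fix z :: complex assume z: "z \<in> ball 0 1"
    show "\<kappa> \<le> cmod (g z)"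
    proof (cases "1 - (cmod (B z))\<^sup>2 \<ge> \<delta>")
      case True
      then obtain i where i: "i \<in> J" "cmod (blaschke_factor (v i) z) \<le> \<rho>" using near[OF z] by blast
      have "cmod a \<le> cmod (g (v i))"
        using g(4)[OF v_in_disc[OF i(1)]] norm_b_at_zero[OF i(1)] by simp
      then have ln: "ln (cmod a) \<le> ln (cmod (g (v i)))"
        using a by (subst ln_le_cancel_iff) auto
      have "- ln (cmod (g z)) \<le> 4 * (1 - ln (cmod (g (v i)))) / (1 - \<rho>\<^sup>2)"
        using v_in_disc[OF i(1)] z i(2) \<rho> by (intro harnack_zero_free g) auto
      also have "\<dots> \<le> K"
        unfolding K_def using ln \<rho> by (intro divide_right_mono) (auto simp: abs_square_le_1)
      finally have "exp (- K) \<le> exp (ln (cmod (g z)))" by simp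
      then show ?thesis using g(3)[OF z] by (simp add: \<kappa>_def)
    next
      case False
      then have "((1 + cmod a) / 2)\<^sup>2 \<le> (cmod (B z))\<^sup>2" by (simp add: \<delta>_def)
      then have "(1 + cmod a) / 2 \<le> cmod (B z)" by (rule power2_le_imp_le) simp
      then have "(1 - cmod a) / 4 \<le> cmod (b z)"
        unfolding b_def by (rule norm_frostman_ge[OF a(2) B_le[OF z]])
      then show ?thesis using g(4)[OF z] unfolding \<kappa>_def by linarith
    qed
  qed
qed

text \<open>
  On the circle \<open>\<bar>z\<bar> = 1 - 2\<^sup>-\<^sup>k\<close> the function \<open>g\<close> can only be small within distance \<open>O(2\<^sup>-\<^sup>k)\<close> of
  one of at most \<open>N\<close> zeros \<open>p\<close> of \<open>B\<close>. The maximum principle for \<open>(\<Prod>p. (z - p) / 2) / g\<^sup>q\<close>, with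
  \<open>k\<close> large in terms of \<open>q\<close>, gives \<open>c\<^sup>q \<le> 4\<^sup>N \<bar>g 0\<bar>\<^sup>q\<close> for every \<open>c < 1\<close>.
\<close>
lemma zero_free_majorant_at_0:
  assumes g: "g holomorphic_on ball 0 1" "\<And>z. z \<in> ball 0 1 \<Longrightarrow> cmod (g z) \<le> 1"
    "\<And>z. z \<in> ball 0 1 \<Longrightarrow> g z \<noteq> 0" "\<And>z. z \<in> ball 0 1 \<Longrightarrow> cmod (b z) \<le> cmod (g z)"
    and c: "0 < c" "c < 1"
  shows "c \<le> cmod (g 0)"
proof -
  obtain \<kappa> where \<kappa>: "0 < \<kappa>" "\<And>z. z \<in> ball 0 1 \<Longrightarrow> \<kappa> \<le> cmod (g z)"
    using zero_free_majorant_bounded_below[OF g] by blast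
  \<comment> \<open>If \<open>|g z| < c\<close>, then \<open>|b z| \<le> c\<close>, and
    \<open>1 - |B z|^2\<close> is at least this \<delta>.\<close>
  define \<delta> where "\<delta> = (1 - c\<^sup>2) * (1 - cmod a)\<^sup>2"
  have "\<delta> > 0" using a c by (simp add: \<delta>_def abs_square_less_1)
  then obtain L \<rho> where \<rho>: "0 < \<rho>" "\<rho> < 1" and near:
    "\<And>z. z \<in> ball 0 1 \<Longrightarrow> 1 - (cmod (B z))\<^sup>2 \<ge> \<delta> \<Longrightarrow>
       \<exists>n\<in>J. disc_level (v n) \<le> disc_level z + L \<and> disc_level z \<le> disc_level (v n) + L \<and>
             cmod (blaschke_factor (v n) z) \<le> \<rho>"
    by (rule bprod_near_zero[OF v M]) (rule that; blast)
  \<comment> \<open>\<open>N\<close> does not depend on \<open>q\<close>, which is what allows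
    \<open>q\<close> to grow at the end.\<close>
  define N where "N = (2 * L + 1) * M"
  have g0: "0 < cmod (g 0)" using g(3)[of 0] by simp
  have main: "c ^ q \<le> 4 ^ N * cmod (g 0) ^ q" for q :: nat
  proof -
    \<comment> \<open>\<open>k0\<close> makes the factor of \<open>P\<close> at a nearby zero of
      \<open>B\<close> at most \<kappa>\<open>^ q\<close>, which compensates the worst size of
      \<open>1 / g ^ q\<close>.\<close>
    have "(1 - \<rho>) * \<kappa> ^ q > 0" using \<rho> \<kappa> by simp
    then obtain k0 where k0: "(1/2) ^ k0 < (1 - \<rho>) * \<kappa> ^ q"
      using real_arch_pow_inv[of "(1 - \<rho>) * \<kappa> ^ q" "1/2"] by auto
    \<comment> \<open>\<open>k > L\<close> puts the zeros indexed by \<open>Q\<close> on levels at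
      least \<open>1\<close>, so they have modulus at least \<open>1/2\<close> and
      \<open>P 0\<close> is not too small.\<close>
    define k where "k = max k0 (L + 1)"
    have "(1/2::real) ^ k \<le> (1/2) ^ k0" by (intro power_decreasing) (auto simp: k_def)
    with k0 have k: "1 / 2 ^ k < (1 - \<rho>) * \<kappa> ^ q" by (simp add: power_one_over)
    define r :: real where "r = 1 - 1 / 2 ^ k"
    have r: "0 \<le> r" "r < 1" by (auto simp: r_def)
    define Q where "Q = {i \<in> J. disc_level (v i) \<le> k + L \<and> k \<le> disc_level (v i) + L}"
    have Q: "finite Q" "card Q \<le> N" "Q \<subseteq> J"
      using level_window_bound[OF v M] by (auto simp: Q_def N_def)
    define P where "P = (\<lambda>z. \<Prod>i\<in>Q. (z - v i) / 2)"
    define F where "F = (\<lambda>z. P z / g z ^ q)"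
    have sub: "cball 0 r \<subseteq> ball (0::complex) 1" using r by auto
    have F_hol: "F holomorphic_on ball 0 1"
      unfolding F_def P_def using g(3) by (intro holomorphic_intros g(1)) auto
    have factor_le: "cmod ((z - v i) / 2) \<le> 1" if "z \<in> ball 0 1" "i \<in> Q" for z :: complex and i
      using norm_triangle_ineq4[of z "v i"] that v_in_disc[of i] Q by (auto simp: norm_divide)
    have "cmod (F 0) \<le> 1 / c ^ q"
    proof (rule maximum_modulus_frontier[of F "cball 0 r"])
      show "F holomorphic_on interior (cball 0 r)"
        using F_hol sub interior_subset by (meson holomorphic_on_subset order_trans)
      show "continuous_on (closure (cball 0 r)) F"
        using F_hol sub by (auto intro: holomorphic_on_imp_continuous_on holomorphic_on_subset)
      fix z :: complex assume "z \<in> frontier (cball 0 r)"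
      then have zr: "cmod z = r" by simp
      then have z: "z \<in> ball 0 1" using r by simp
      have lev: "disc_level z = k"
        by (rule disc_level_eqI) (auto simp: zr r_def field_simps)
      show "cmod (F z) \<le> 1 / c ^ q"
      proof (cases "c \<le> cmod (g z)")
        case True
        have "cmod (P z) \<le> 1"
          unfolding P_def prod_norm[symmetric] using factor_le z by (intro prod_le_1) auto
        moreover have "c ^ q \<le> cmod (g z) ^ q" using True c by (intro power_mono) auto
        ultimately show ?thesis
          using c by (simp add: F_def norm_divide norm_power frac_le)
      next
        case False
        then have "cmod (b z) \<le> c" using g(4)[OF z] by simp
        then have "(cmod (b z))\<^sup>2 \<le> c\<^sup>2" by (intro power_mono) auto
        then have "\<delta> \<le> (1 - (cmod (b z))\<^sup>2) * (1 - cmod a)\<^sup>2"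
          unfolding \<delta>_def by (intro mult_right_mono) auto
        also have "\<dots> \<le> 1 - (cmod (B z))\<^sup>2"
          unfolding b_def by (rule one_minus_norm_sq_ge_frostman[OF a(2) B_le[OF z]])
        finally obtain i where i: "i \<in> Q" "i \<in> J" "cmod (blaschke_factor (v i) z) \<le> \<rho>"
          using near[OF z] lev by (auto simp: Q_def)
        have "cmod (z - v i) \<le> 2 * (1 - cmod z) / (1 - \<rho>)"
          using v_in_disc[OF i(2)] z i \<rho> by (intro dist_le_of_norm_blaschke_factor_le) auto
        also have "\<dots> = 2 * (1 / 2 ^ k / (1 - \<rho>))" by (simp add: zr r_def)
        also have "\<dots> \<le> 2 * \<kappa> ^ q"
          using k \<rho> by (simp add: field_simps)
        finally have small: "cmod ((z - v i) / 2) \<le> \<kappa> ^ q" by (simp add: norm_divide)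
        have "cmod (P z) = cmod ((z - v i) / 2) * (\<Prod>j\<in>Q - {i}. cmod ((z - v j) / 2))"
          unfolding P_def prod_norm[symmetric] using Q i by (intro prod.remove) auto
        also have "\<dots> \<le> \<kappa> ^ q * 1"
          using small factor_le z \<kappa> by (intro mult_mono prod_le_1 prod_nonneg) auto
        finally have "cmod (P z) \<le> \<kappa> ^ q" by simp
        also have "\<dots> \<le> cmod (g z) ^ q" using \<kappa> z by (intro power_mono) auto
        finally have "cmod (F z) \<le> 1"
          using g(3)[OF z] by (simp add: F_def norm_divide norm_power divide_le_eq)
        also have "1 \<le> 1 / c ^ q" using c by (simp add: power_le_one)
        finally show ?thesis .
      qed
    qed (use r in auto)
    moreover have "(1/4) ^ N \<le> cmod (P 0)"
    proof -
      have "(1/4::real) ^ N \<le> (1/4) ^ card Q" using Q by (intro power_decreasing) auto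
      also have "\<dots> = (\<Prod>i\<in>Q. 1/4)" by simp
      also have "\<dots> \<le> (\<Prod>i\<in>Q. cmod ((0 - v i) / 2))"
      proof (rule prod_mono)
        fix i assume i: "i \<in> Q"
        have "disc_level (v i) \<ge> 1" using i by (auto simp: Q_def k_def)
        then have "(1/2::real) ^ disc_level (v i) \<le> (1/2) ^ 1" by (intro power_decreasing) auto
        then have half: "1 / 2 ^ disc_level (v i) \<le> (1/2::real)" by (simp add: power_one_over)
        have "cmod (v i) < 1" using v_in_disc[of i] i Q by auto
        then have "1 - cmod (v i) \<le> 1 / 2" using disc_level(2)[of "v i"] half by linarith
        then show "0 \<le> (1/4::real) \<and> 1/4 \<le> cmod ((0 - v i) / 2)" by (simp add: norm_divide)
      qed
      finally show ?thesis unfolding P_def prod_norm[symmetric] .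
    qed
    ultimately have "(1/4) ^ N / cmod (g 0) ^ q \<le> 1 / c ^ q"
      using g0 by (simp add: F_def norm_divide norm_power)
         (meson divide_right_mono order_trans zero_le_power norm_ge_zero)
    then show ?thesis
      using g0 c by (simp add: power_one_over field_simps)
  qed
  show ?thesis
  proof (rule ccontr)
    assume "\<not> c \<le> cmod (g 0)"
    then have "1 < c / cmod (g 0)" using g0 by simp
    \<comment> \<open>The powers of a number above \<open>1\<close> would outgrow the fixed bound
      \<open>4 ^ N\<close>.\<close>
    then obtain q where "4 ^ N < (c / cmod (g 0)) ^ q" using real_arch_pow by blast
    then show False using main[of q] g0 by (simp add: power_divide field_simps)
  qed
qed

lemma frostman_shift_exponential:
  "\<exists>c b'. cmod c = 1 \<and> exponential_blaschke_product b' \<and> (\<forall>z\<in>ball 0 1. b z = c * b' z)"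
proof -
  obtain \<beta> where \<beta>: "\<beta> \<in> ball 0 1" "b \<beta> \<noteq> 0" by (rule b_not_identically_0)
  obtain I w where ez: "enumerated_zeros b I w \<beta>"
    by (rule zero_enumeration[OF b_holomorphic \<beta> b_le])
  interpret enumerated_zeros b I w \<beta> by (rule ez)
  obtain C where C: "\<And>k. card {n \<in> I. disc_level (w n) = k} \<le> C"
    using level_bound[OF ez] by blast
  obtain g where g: "g holomorphic_on ball 0 1" "\<And>z. z \<in> ball 0 1 \<Longrightarrow> b z = bprod I w z * g z"
    "\<And>z. z \<in> ball 0 1 \<Longrightarrow> cmod (g z) \<le> 1" "\<And>z. z \<in> ball 0 1 \<Longrightarrow> g z \<noteq> 0"
    using zero_free_factor by blast
  have b_le_g: "cmod (b z) \<le> cmod (g z)" if "z \<in> ball 0 1" for z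
    using norm_bprod_le_1[OF blaschke_sequence that] g(2)[OF that]
    by (simp add: norm_mult mult_left_le_one_le)
  have "c \<le> cmod (g 0)" if "0 < c" "c < 1" for c
    by (rule zero_free_majorant_at_0[OF g(1,3,4) b_le_g that])
  then have "1 \<le> cmod (g 0)"
    by (intro dense_le_bounded[of 0 1]) auto
  then have g0: "cmod (g 0) = 1" using g(3)[of 0] by simp
  \<comment> \<open>\<open>|g|\<close> attains its maximum \<open>1\<close> at the interior point
    \<open>0\<close>.\<close>
  have "g constant_on ball 0 1"
    using g(3) g0
    by (intro maximum_modulus_principle[OF g(1) open_ball connected_ball open_ball order_refl, of 0]) auto
  then have const: "g z = g 0" if "z \<in> ball 0 1" for z
    using that unfolding constant_on_def by (metis centre_in_ball zero_less_one)
  show ?thesis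
  proof (intro exI conjI ballI)
    show "cmod (g 0) = 1" by (rule g0)
    show "exponential_blaschke_product (bprod I w)"
      by (rule level_bound_imp_exponential[OF blaschke_sequence C])
    show "b z = g 0 * bprod I w z" if "z \<in> ball 0 1" for z
      using g(2)[OF that] const[OF that] by simp
  qed
qed

end

theorem mainTheorem2:
  fixes B :: "complex \<Rightarrow> complex" and a :: complex
  assumes "exponential_blaschke_product B"
    and "a \<in> ball 0 1"
  shows "\<exists>c b. cmod c = 1 \<and> exponential_blaschke_product b \<and>
           (\<forall>z\<in>ball 0 1. (B z - a) / (1 - cnj a * B z) = c * b z)"
proof (cases "a = 0")
  case True
  then show ?thesis using assms(1) by (intro exI[of _ 1] exI[of _ B]) auto
next
  case False
  obtain J v where v: "blaschke_sequence J v" and eq: "\<And>z. z \<in> ball 0 1 \<Longrightarrow> B z = bprod J v z"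
    using assms(1) blaschke_productE unfolding exponential_blaschke_product_def by metis
  obtain M where "\<And>k. card {n \<in> J. disc_level (v n) = k} \<le> M"
    using exponential_imp_level_bound[OF assms(1) v eq] by blast
  then interpret frostman_shift J v M a
    using v False assms(2) by unfold_locales auto
  show ?thesis
    using frostman_shift_exponential by (simp add: b_def eq)
qed

end
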